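(* Let $\boldsymbol{X}$, $\boldsymbol{Y}$ and $\boldsymbol{Z}$ be arbitrary compound random sequences. Then: $$\underline{\underline{D}}(\boldsymbol{X}||\boldsymbol{Y})\ge0,$$ $$\overline{\overline{I}}(\boldsymbol{X};\boldsymbol{Y})\ge\underline{\underline{I}}(\boldsymbol{X};\boldsymbol{Y})\ge0,$$ $$\underline{\underline{I}}(\boldsymbol{X};\boldsymbol{Y})=\underline{\underline{I}}(\boldsymbol{Y};\boldsymbol{X}),$$ $$\underline{\underline{I}}(\boldsymbol{X};\boldsymbol{Y})\le\overline{\overline{H}}(\boldsymbol{Y})-\overline{\overline{H}}(\boldsymbol{Y}|\boldsymbol{X}),$$ $$\underline{\underline{I}}(\boldsymbol{X};\boldsymbol{Y})\le\underline{\underline{H}}(\boldsymbol{Y})-\underline{\underline{H}}(\boldsymbol{Y}|\boldsymbol{X}),$$ $$\underline{\underline{I}}(\boldsymbol{X};\boldsymbol{Y})\ge\underline{\underline{H}}(\boldsymbol{Y})-\overline{\overline{H}}(\boldsymbol{Y}|\boldsymbol{X}),$$ $$\overline{\overline{H}}(\boldsymbol{Y})\ge\overline{\overline{H}}(\boldsymbol{Y}|\boldsymbol{X}),$$ $$\overline{\overline{H}}(\boldsymbol{Y})\ge\underline{\underline{H}}(\boldsymbol{Y})\ge\underline{\underline{H}}(\boldsymbol{Y}|\boldsymbol{X}),$$ $$\underline{\underline{I}}(\boldsymbol{X},\boldsymbol{Y};\boldsymbol{Z})\ge\underline{\underline{I}}(\boldsymbol{X};\boldsymbol{Z})+\underline{\underline{I}}(\boldsymbol{Y};\boldsymbol{Z}|\boldsymbol{X})\ge\underline{\underline{I}}(\boldsymbol{X};\boldsymbol{Z}),$$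 the last line with equality if $\overline{\overline{I}}(\boldsymbol{Y};\boldsymbol{Z}|\boldsymbol{X})=0$. If the alphabets are discrete, then $$0\le\underline{\underline{H}}(\boldsymbol{X}|\boldsymbol{Y})\le\underline{\underline{H}}(\boldsymbol{X})\le\overline{\overline{H}}(\boldsymbol{X})\le\ln N_x,$$ $$0\le\underline{\underline{I}}(\boldsymbol{X};\boldsymbol{Y})\le\min\{\underline{\underline{H}}(\boldsymbol{X}),\underline{\underline{H}}(\boldsymbol{Y})\}\le\min\{\ln N_x,\ln N_y\},$$ $$\underline{\underline{I}}(\boldsymbol{X};\boldsymbol{Y})=\min\{\underline{\underline{H}}(\boldsymbol{X}),\underline{\underline{H}}(\boldsymbol{Y})\}\ \text{ if }\ \min\{\overline{\overline{H}}(\boldsymbol{Y}|\boldsymbol{X}),\overline{\overline{H}}(\boldsymbol{X}|\boldsymbol{Y})\}=0,$$ $$0\le\overline{\overline{I}}(\boldsymbol{X};\boldsymbol{Y})\le\min\{\overline{\overline{H}}(\boldsymbol{X}),\overline{\overline{H}}(\boldsymbol{Y})\}\le\min\{\ln N_x,\ln N_y\},$$ where the last inequalities (those involving $\ln N_x$, $\ln N_y$) hold if the alphabets are of finite cardinality $N_x,N_y$.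
   Context: For a family $\{W_{ns}\}$ of real random variables indexed by $n\ge1$ and a state $s$ in an arbitrary set, let $$\underline{\underline{\{W_{ns}\}}}=\sup\{x:\lim_{n\to\infty}\sup_s\Pr\{W_{ns}\le x\}=0\},\qquad\overline{\overline{\{W_{ns}\}}}=\inf\{x:\lim_{n\to\infty}\sup_s\Pr\{W_{ns}\ge x\}=0\}.$$ Compound random sequences $\boldsymbol{X}=\{X^n\}$, $\boldsymbol{Y}=\{Y^n\}$, $\boldsymbol{Z}=\{Z^n\}$ are sequences of random $n$-vectors whose joint distribution $p_s$ depends on a common state $s$; $p_s(x^n)$ (also $p_{sx^n}$), $p_s(y^n)$ (also $p_{sy^n}$), $p_s(y^n|x^n)$ etc. denote the marginal and conditional distributions (densities) under $s$. Define $$\underline{\underline{D}}(\boldsymbol{X}||\boldsymbol{Y})=\underline{\underline{\Big\{\tfrac1n\ln\tfrac{p_{sx^n}(X^n)}{p_{sy^n}(X^n)}\Big\}}}\ \text{ (compound inf-divergence rate)},$$ $$\underline{\underline{H}}(\boldsymbol{X})=\underline{\underline{\{-\tfrac1n\ln p_s(X^n)\}}},\quad\overline{\overline{H}}(\boldsymbol{X})=\overline{\overline{\{-\tfrac1n\ln p_s(X^n)\}}},$$ $$\underline{\underline{H}}(\boldsymbol{Y}|\boldsymbol{X})=\underline{\underline{\{-\tfrac1n\ln p_s(Y^n|X^n)\}}},\quad\overline{\overline{H}}(\boldsymbol{Y}|\boldsymbol{X})=\overline{\overline{\{-\tfrac1n\ln p_s(Y^n|X^n)\}}},$$ $$\underline{\underline{I}}(\boldsymbol{X};\boldsymbol{Y})=\underline{\underline{\{\tfrac1n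 i(X^n;Y^n|s)\}}},\quad\overline{\overline{I}}(\boldsymbol{X};\boldsymbol{Y})=\overline{\overline{\{\tfrac1n i(X^n;Y^n|s)\}}},\quad i(x^n;y^n|s)=\ln\tfrac{p_s(x^n,y^n)}{p_s(x^n)p_s(y^n)}.$$ $\underline{\underline{I}}(\boldsymbol{X},\boldsymbol{Y};\boldsymbol{Z})$ is defined with $i(x^n,y^n;z^n|s)=\ln\frac{p_s(z^n|x^n,y^n)}{p_s(z^n)}$, and $\underline{\underline{I}}(\boldsymbol{Y};\boldsymbol{Z}|\boldsymbol{X})$, $\overline{\overline{I}}(\boldsymbol{Y};\boldsymbol{Z}|\boldsymbol{X})$ with $i(y^n;z^n|x^n,s)=\ln\frac{p_s(z^n|x^n,y^n)}{p_s(z^n|x^n)}$. *)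

theory Defs
  imports "HOL-Probability.Probability"
begin

text \<open>
  The state ranges over a type \<open>'s\<close>; the family \<open>P :: 's \<Rightarrow> 'w measure\<close> gives the underlying
  probability space under each state.  Random variables may take the values \<open>\<infinity>\<close> and \<open>-\<infinity>\<close>, since
  a log-likelihood ratio of two arbitrary laws is infinite with positive probability in general.
\<close>

definition compound_inf :: "('s \<Rightarrow> 'w measure) \<Rightarrow> (nat \<Rightarrow> 's \<Rightarrow> 'w \<Rightarrow> ereal) \<Rightarrow> ereal" where
  "compound_inf P W =
    Sup {ereal x | x :: real. (\<lambda>n. SUP s. \<P>(\<omega> in P s. W n s \<omega> \<le> ereal x)) \<longlonglongrightarrow> 0}"

definition compound_sup :: "('s \<Rightarrow> 'w measure) \<Rightarrow> (nat \<Rightarrow> 's \<Rightarrow> 'w \<Rightarrow> ereal) \<Rightarrow> ereal" where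
  "compound_sup P W =
    Inf {ereal x | x :: real. (\<lambda>n. SUP s. \<P>(\<omega> in P s. W n s \<omega> \<ge> ereal x)) \<longlonglongrightarrow> 0}"

text \<open>
  A sequence of random elements: for each \<open>n\<close> a reference measure \<open>ref\<close> (with respect to which
  densities are taken; counting measure in the discrete case) and a random element \<open>rv\<close>.
\<close>

record ('w, 'v) rseq =
  ref :: "nat \<Rightarrow> 'v measure"
  rv :: "nat \<Rightarrow> 'w \<Rightarrow> 'v"

text \<open>\<open>n\<close>-vectors over the alphabet \<open>M\<close>, referred to the \<open>n\<close>-fold product of \<open>M\<close>.\<close>

definition vector_rseq :: "'a measure \<Rightarrow> ('w, nat \<Rightarrow> 'a) rseq \<Rightarrow> bool" where
  "vector_rseq M X \<longleftrightarrow> (\<forall>n\<ge>1. ref X n = PiM {..<n} (\<lambda>_. M))"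

definition joint :: "('w, 'u) rseq \<Rightarrow> ('w, 'v) rseq \<Rightarrow> ('w, 'u \<times> 'v) rseq" where
  "joint U V = \<lparr>ref = (\<lambda>n. ref U n \<Otimes>\<^sub>M ref V n), rv = (\<lambda>n \<omega>. (rv U n \<omega>, rv V n \<omega>))\<rparr>"

definition has_density :: "('s \<Rightarrow> 'w measure) \<Rightarrow> ('w, 'v) rseq \<Rightarrow> bool" where
  "has_density P V \<longleftrightarrow> (\<forall>s. \<forall>n\<ge>1. \<exists>f. distributed (P s) (ref V n) (rv V n) f)"

definition dens :: "('s \<Rightarrow> 'w measure) \<Rightarrow> ('w, 'v) rseq \<Rightarrow> nat \<Rightarrow> 's \<Rightarrow> 'v \<Rightarrow> ennreal" where
  "dens P V n s = RN_deriv (ref V n) (distr (P s) (ref V n) (rv V n))"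

text \<open>\<open>cond_dens P V U n s v u\<close> is \<open>p\<^sub>s(v|u)\<close>.\<close>

definition cond_dens ::
  "('s \<Rightarrow> 'w measure) \<Rightarrow> ('w, 'v) rseq \<Rightarrow> ('w, 'u) rseq \<Rightarrow> nat \<Rightarrow> 's \<Rightarrow> 'v \<Rightarrow> 'u \<Rightarrow> ennreal" where
  "cond_dens P V U n s v u = dens P (joint U V) n s (u, v) / dens P U n s u"

text \<open>
  Extended natural logarithm.  In \<^typ>\<open>ennreal\<close>, \<open>a / 0 = \<infinity>\<close> for \<open>a > 0\<close>, so a likelihood ratio with
  vanishing denominator has logarithm \<open>\<infinity>\<close>.
\<close>

definition ln_ext :: "ennreal \<Rightarrow> ereal" where
  "ln_ext p = (if p = 0 then -\<infinity> else if p = \<infinity> then \<infinity> else ereal (ln (enn2real p)))"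

definition div_rate ::
  "('s \<Rightarrow> 'w measure) \<Rightarrow> ('w, 'v) rseq \<Rightarrow> ('w, 'v) rseq \<Rightarrow> nat \<Rightarrow> 's \<Rightarrow> 'w \<Rightarrow> ereal" where
  "div_rate P X Y n s \<omega> =
    ereal (1 / real n) * ln_ext (dens P X n s (rv X n \<omega>) / dens P Y n s (rv X n \<omega>))"

definition ent_rate ::
  "('s \<Rightarrow> 'w measure) \<Rightarrow> ('w, 'v) rseq \<Rightarrow> nat \<Rightarrow> 's \<Rightarrow> 'w \<Rightarrow> ereal" where
  "ent_rate P X n s \<omega> = - (ereal (1 / real n) * ln_ext (dens P X n s (rv X n \<omega>)))"

definition cond_ent_rate ::
  "('s \<Rightarrow> 'w measure) \<Rightarrow> ('w, 'v) rseq \<Rightarrow> ('w, 'u) rseq \<Rightarrow> nat \<Rightarrow> 's \<Rightarrow> 'w \<Rightarrow> ereal" where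
  "cond_ent_rate P Y X n s \<omega> =
    - (ereal (1 / real n) * ln_ext (cond_dens P Y X n s (rv Y n \<omega>) (rv X n \<omega>)))"

definition info_rate ::
  "('s \<Rightarrow> 'w measure) \<Rightarrow> ('w, 'u) rseq \<Rightarrow> ('w, 'v) rseq \<Rightarrow> nat \<Rightarrow> 's \<Rightarrow> 'w \<Rightarrow> ereal" where
  "info_rate P X Y n s \<omega> =
    ereal (1 / real n) *
      ln_ext (dens P (joint X Y) n s (rv X n \<omega>, rv Y n \<omega>) /
        (dens P X n s (rv X n \<omega>) * dens P Y n s (rv Y n \<omega>)))"

definition pair_info_rate ::
  "('s \<Rightarrow> 'w measure) \<Rightarrow> ('w, 'u) rseq \<Rightarrow> ('w, 'v) rseq \<Rightarrow> ('w, 'z) rseq \<Rightarrow>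
    nat \<Rightarrow> 's \<Rightarrow> 'w \<Rightarrow> ereal" where
  "pair_info_rate P X Y Z n s \<omega> =
    ereal (1 / real n) *
      ln_ext (cond_dens P Z (joint X Y) n s (rv Z n \<omega>) (rv X n \<omega>, rv Y n \<omega>) /
        dens P Z n s (rv Z n \<omega>))"

text \<open>\<open>cond_info_rate P Y Z X\<close> is the rate of \<open>i(y;z|x)\<close>.\<close>

definition cond_info_rate ::
  "('s \<Rightarrow> 'w measure) \<Rightarrow> ('w, 'v) rseq \<Rightarrow> ('w, 'z) rseq \<Rightarrow> ('w, 'u) rseq \<Rightarrow>
    nat \<Rightarrow> 's \<Rightarrow> 'w \<Rightarrow> ereal" where
  "cond_info_rate P Y Z X n s \<omega> =
    ereal (1 / real n) *
      ln_ext (cond_dens P Z (joint X Y) n s (rv Z n \<omega>) (rv X n \<omega>, rv Y n \<omega>) /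
        cond_dens P Z X n s (rv Z n \<omega>) (rv X n \<omega>))"

definition inf_D where "inf_D P X Y = compound_inf P (div_rate P X Y)"

definition inf_H where "inf_H P X = compound_inf P (ent_rate P X)"
definition sup_H where "sup_H P X = compound_sup P (ent_rate P X)"

definition inf_H_cond where "inf_H_cond P Y X = compound_inf P (cond_ent_rate P Y X)"
definition sup_H_cond where "sup_H_cond P Y X = compound_sup P (cond_ent_rate P Y X)"

definition inf_I where "inf_I P X Y = compound_inf P (info_rate P X Y)"
definition sup_I where "sup_I P X Y = compound_sup P (info_rate P X Y)"

definition inf_I_pair where "inf_I_pair P X Y Z = compound_inf P (pair_info_rate P X Y Z)"

definition inf_I_cond where "inf_I_cond P Y Z X = compound_inf P (cond_info_rate P Y Z X)"
definition sup_I_cond where "sup_I_cond P Y Z X = compound_sup P (cond_info_rate P Y Z X)"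

text \<open>
  Rates may be infinite (differential entropies, infinite alphabets).  A difference is meaningful
  unless it is \<open>\<infinity> - \<infinity>\<close> or \<open>(-\<infinity>) - (-\<infinity>)\<close>, to which \<^typ>\<open>ereal\<close> assigns the arbitrary value \<open>\<infinity>\<close>.
\<close>

definition diff_defined :: "ereal \<Rightarrow> ereal \<Rightarrow> bool" where
  "diff_defined a b \<longleftrightarrow> \<not> (a = b \<and> \<bar>a\<bar> = \<infinity>)"

definition discrete_alphabet :: "'a measure \<Rightarrow> bool" where
  "discrete_alphabet M \<longleftrightarrow> countable (space M) \<and> M = count_space (space M)"

abbreviation ln_card :: "'a measure \<Rightarrow> ereal" where
  "ln_card M \<equiv> ereal (ln (real (card (space M))))"

end

theory Submission
  imports Defs
begin

text \<open>
  Everything follows from two facts.  First, if \<open>G\<close> is a nonnegative function with integral at most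
  \<open>1\<close>, then the law of a random element \<open>V\<close> with density \<open>f\<close> gives the event
  \<open>f(V) \<le> e\<^sup>n\<^sup>x G(V)\<close> probability at most \<open>e\<^sup>n\<^sup>x\<close>, uniformly in the state; for \<open>x < 0\<close> this tends to \<open>0\<close>,
  so the divergence and information rates are nonnegative.  For the conditional information rate one
  takes \<open>G(x,y,z) = p(x,y) p(x,z) / p(x)\<close>.  Second, the lower limit in probability is superadditive, and
  the upper one is its dual under \<open>W \<mapsto> -W\<close>.  Since densities are almost surely positive and finite at
  the sample, the chain rules \<open>h(y) = i(x;y) + h(y|x)\<close> and \<open>i(x,y;z) = i(x;z) + i(y;z|x)\<close> are almost sure
  identities between real numbers, and superadditivity applied to their rearrangements gives all the
  remaining inequalities.
\<close>

subsection \<open>Limits in probability, uniform in the state\<close>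

text \<open>Isolates the condition on the thresholds in \<open>compound_inf\<close>, for arbitrary
  events instead of \<open>W \<le> x\<close>, so that the union bound can be applied to it.\<close>

definition uniformly_null :: "('s \<Rightarrow> 'w measure) \<Rightarrow> (nat \<Rightarrow> 's \<Rightarrow> 'w \<Rightarrow> bool) \<Rightarrow> bool" where
  "uniformly_null P Q \<longleftrightarrow> (\<lambda>n. SUP s. \<P>(\<omega> in P s. Q n s \<omega>)) \<longlonglongrightarrow> 0"

text \<open>Only \<open>n \<ge> 1\<close> is constrained: densities are supposed to exist only
  there, and a limit does not see \<open>n = 0\<close>.\<close>

definition measurable_rate :: "('s \<Rightarrow> 'w measure) \<Rightarrow> (nat \<Rightarrow> 's \<Rightarrow> 'w \<Rightarrow> ereal) \<Rightarrow> bool" where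
  "measurable_rate P W \<longleftrightarrow> (\<forall>n\<ge>1. \<forall>s. W n s \<in> borel_measurable (P s))"

lemma measurable_rateD: "measurable_rate P W \<Longrightarrow> n \<ge> 1 \<Longrightarrow> W n s \<in> borel_measurable (P s)"
  by (simp add: measurable_rate_def)

lemma measurable_rate_uminus:
  "measurable_rate P W \<Longrightarrow> measurable_rate P (\<lambda>n s \<omega>. - W n s \<omega>)"
  by (simp add: measurable_rate_def)

text \<open>The event \<open>W \<ge> x\<close> is the event \<open>-W \<le> -x\<close>. Through this
  duality facts about upper rates are obtained from those about lower rates.\<close>

lemma compound_sup_eq_uminus_compound_inf:
  "compound_sup P W = - compound_inf P (\<lambda>n s \<omega>. - W n s \<omega>)"
proof -
  have "{ereal x | x :: real. (\<lambda>n. SUP s. \<P>(\<omega> in P s. W n s \<omega> \<ge> ereal x)) \<longlonglongrightarrow> 0} =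
    uminus ` {ereal x | x :: real. (\<lambda>n. SUP s. \<P>(\<omega> in P s. - W n s \<omega> \<le> ereal x)) \<longlonglongrightarrow> 0}"
    (is "?A = uminus ` ?B")
  proof (intro set_eqI iffI)
    fix y assume "y \<in> ?A"
    then obtain x where x: "y = ereal x"
      "(\<lambda>n. SUP s. \<P>(\<omega> in P s. W n s \<omega> \<ge> ereal x)) \<longlonglongrightarrow> 0" by auto
    have eq: "- W n s \<omega> \<le> ereal (- x) \<longleftrightarrow> ereal x \<le> W n s \<omega>" for n s \<omega>
      by (metis ereal_minus_le_minus uminus_ereal.simps(1))
    have "ereal (- x) \<in> ?B"
      using x(2) unfolding eq[symmetric] by blast
    then show "y \<in> uminus ` ?B"
      using x(1) by (intro image_eqI[where x = "ereal (- x)"]) auto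
  next
    fix y assume "y \<in> uminus ` ?B"
    then obtain x where x: "y = ereal (- x)"
      "(\<lambda>n. SUP s. \<P>(\<omega> in P s. - W n s \<omega> \<le> ereal x)) \<longlonglongrightarrow> 0" by auto
    have eq: "- W n s \<omega> \<le> ereal x \<longleftrightarrow> ereal (- x) \<le> W n s \<omega>" for n s \<omega>
      by (metis ereal_minus_le_minus ereal_uminus_uminus uminus_ereal.simps(1))
    show "y \<in> ?A"
      using x(2) unfolding eq x(1) by blast
  qed
  then show ?thesis
    unfolding compound_sup_def compound_inf_def by (simp add: ereal_Inf_uminus_image_eq)
qed

locale compound_space =
  fixes P :: "'s \<Rightarrow> 'w measure"
  assumes prob_space_P: "\<And>s. prob_space (P s)"
begin

lemma bdd_above_prob: "bdd_above (range (\<lambda>s. \<P>(\<omega> in P s. Q s \<omega>)))"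
  by (intro bdd_aboveI[where M = 1]) (auto intro: prob_space.prob_le_1[OF prob_space_P])

lemma uniformly_nullI_bound:
  assumes "\<And>n s. n \<ge> 1 \<Longrightarrow> \<P>(\<omega> in P s. Q n s \<omega>) \<le> c n" and "c \<longlonglongrightarrow> 0"
  shows "uniformly_null P Q"
  unfolding uniformly_null_def
proof (rule tendsto_sandwich[OF _ _ tendsto_const assms(2)])
  show "\<forall>\<^sub>F n in sequentially. 0 \<le> (SUP s. \<P>(\<omega> in P s. Q n s \<omega>))"
    by (auto intro!: always_eventually cSUP_upper2[OF bdd_above_prob])
  show "\<forall>\<^sub>F n in sequentially. (SUP s. \<P>(\<omega> in P s. Q n s \<omega>)) \<le> c n"
    using eventually_ge_at_top[of 1]
    by eventually_elim (auto intro!: cSUP_least assms(1))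
qed

text \<open>The union bound, uniformly in \<open>s\<close>. The covering need only be almost sure,
  which is how identities between densities, valid only almost surely, will enter.\<close>

lemma uniformly_null_disj:
  assumes "uniformly_null P Q1" and "uniformly_null P Q2"
    and "\<And>n s. n \<ge> 1 \<Longrightarrow> {\<omega> \<in> space (P s). Q1 n s \<omega>} \<in> sets (P s)"
    and "\<And>n s. n \<ge> 1 \<Longrightarrow> {\<omega> \<in> space (P s). Q2 n s \<omega>} \<in> sets (P s)"
    and "\<And>n s. n \<ge> 1 \<Longrightarrow> AE \<omega> in P s. Q n s \<omega> \<longrightarrow> Q1 n s \<omega> \<or> Q2 n s \<omega>"
  shows "uniformly_null P Q"
proof (rule uniformly_nullI_bound)
  fix n :: nat and s :: 's
  assume n: "n \<ge> 1"
  interpret prob_space "P s" by (rule prob_space_P)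
  have "prob {\<omega> \<in> space (P s). Q n s \<omega>} \<le>
      prob ({\<omega> \<in> space (P s). Q1 n s \<omega>} \<union> {\<omega> \<in> space (P s). Q2 n s \<omega>})"
    using assms(5)[OF n, of s]
    by (intro finite_measure_mono_AE sets.Un assms(3,4) n) (auto elim!: eventually_mono)
  also have "\<dots> \<le> prob {\<omega> \<in> space (P s). Q1 n s \<omega>} + prob {\<omega> \<in> space (P s). Q2 n s \<omega>}"
    by (intro measure_Un_le assms(3,4) n)
  also have "\<dots> \<le> (SUP s. \<P>(\<omega> in P s. Q1 n s \<omega>)) + (SUP s. \<P>(\<omega> in P s. Q2 n s \<omega>))"
    by (intro add_mono cSUP_upper bdd_above_prob) auto
  finally show "\<P>(\<omega> in P s. Q n s \<omega>) \<le> \<dots>" .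
next
  show "(\<lambda>n. (SUP s. \<P>(\<omega> in P s. Q1 n s \<omega>)) + (SUP s. \<P>(\<omega> in P s. Q2 n s \<omega>))) \<longlonglongrightarrow> 0"
    using tendsto_add[OF assms(1,2)[unfolded uniformly_null_def]] by simp
qed

lemma uniformly_null_mono:
  assumes "uniformly_null P Q1"
    and "\<And>n s. n \<ge> 1 \<Longrightarrow> {\<omega> \<in> space (P s). Q1 n s \<omega>} \<in> sets (P s)"
    and "\<And>n s. n \<ge> 1 \<Longrightarrow> AE \<omega> in P s. Q n s \<omega> \<longrightarrow> Q1 n s \<omega>"
  shows "uniformly_null P Q"
  by (rule uniformly_null_disj[OF assms(1,1,2,2)]) (use assms(3) in auto)

lemma not_uniformly_null_True: "\<not> uniformly_null P (\<lambda>n s \<omega>. True)"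
proof -
  have "\<P>(\<omega> in P s. True) = 1" for s
    using prob_space.prob_space[OF prob_space_P] by simp
  then show ?thesis
    by (auto simp: uniformly_null_def LIMSEQ_const_iff)
qed

lemma sets_rate_le:
  "measurable_rate P W \<Longrightarrow> n \<ge> 1 \<Longrightarrow> {\<omega> \<in> space (P s). W n s \<omega> \<le> c} \<in> sets (P s)"
  using measurable_rateD[of P W n s] by measurable

section \<open>Order and additivity of the lower limit in probability\<close>

text \<open>The reals are dense in \<open>ereal\<close>, so real thresholds below \<open>c\<close>
  suffice, also when \<open>c\<close> is infinite.\<close>

lemma le_compound_infI:
  assumes "\<And>x. ereal x < c \<Longrightarrow> uniformly_null P (\<lambda>n s \<omega>. W n s \<omega> \<le> ereal x)"
  shows "c \<le> compound_inf P W"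
proof (rule dense_le)
  fix y assume "y < c"
  then obtain x where "y < ereal x" "ereal x < c"
    using ereal_dense2 by blast
  then have "ereal x \<le> compound_inf P W"
    using assms unfolding compound_inf_def uniformly_null_def by (intro Sup_upper) auto
  with \<open>y < ereal x\<close> show "y \<le> compound_inf P W" by simp
qed

text \<open>The admissible thresholds form a down-closed set: some admissible \<open>y\<close>
  exceeds \<open>x\<close>, and the event \<open>W \<le> x\<close> is contained in
  \<open>W \<le> y\<close>.\<close>

lemma less_compound_infD:
  assumes "ereal x < compound_inf P W" and "measurable_rate P W"
  shows "uniformly_null P (\<lambda>n s \<omega>. W n s \<omega> \<le> ereal x)"
proof -
  obtain y where y: "ereal x < ereal y" "uniformly_null P (\<lambda>n s \<omega>. W n s \<omega> \<le> ereal y)"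
    using assms(1) unfolding compound_inf_def less_Sup_iff uniformly_null_def mem_Collect_eq by blast
  show ?thesis
  proof (rule uniformly_null_mono[OF y(2) sets_rate_le[OF assms(2)]])
    show "AE \<omega> in P s. W n s \<omega> \<le> ereal x \<longrightarrow> W n s \<omega> \<le> ereal y" for n s
      using y(1) by (intro AE_I2) (meson less_imp_le order_trans)
  qed
qed

lemma compound_inf_mono:
  assumes "measurable_rate P W" and "\<And>n s. n \<ge> 1 \<Longrightarrow> AE \<omega> in P s. W n s \<omega> \<le> W' n s \<omega>"
  shows "compound_inf P W \<le> compound_inf P W'"
proof (rule le_compound_infI)
  fix x assume "ereal x < compound_inf P W"
  from less_compound_infD[OF this assms(1)]
  show "uniformly_null P (\<lambda>n s \<omega>. W' n s \<omega> \<le> ereal x)"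
  proof (rule uniformly_null_mono[OF _ sets_rate_le[OF assms(1)]])
    fix n :: nat and s :: 's
    assume "n \<ge> 1"
    from assms(2)[OF this]
    show "AE \<omega> in P s. W' n s \<omega> \<le> ereal x \<longrightarrow> W n s \<omega> \<le> ereal x"
      by eventually_elim (blast intro: order_trans)
  qed
qed

lemma compound_sup_mono:
  assumes "measurable_rate P W'" and "\<And>n s. n \<ge> 1 \<Longrightarrow> AE \<omega> in P s. W n s \<omega> \<le> W' n s \<omega>"
  shows "compound_sup P W \<le> compound_sup P W'"
  using compound_inf_mono[OF measurable_rate_uminus[OF assms(1)], of "\<lambda>n s \<omega>. - W n s \<omega>"] assms(2)
  by (simp add: compound_sup_eq_uminus_compound_inf)

lemma compound_inf_cong:
  assumes "measurable_rate P W" and "measurable_rate P W'"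
    and "\<And>n s. n \<ge> 1 \<Longrightarrow> AE \<omega> in P s. W n s \<omega> = W' n s \<omega>"
  shows "compound_inf P W = compound_inf P W'"
proof (rule antisym)
  have "AE \<omega> in P s. W n s \<omega> \<le> W' n s \<omega>" if "n \<ge> 1" for n s
    using assms(3)[OF that] by eventually_elim simp
  then show "compound_inf P W \<le> compound_inf P W'"
    by (rule compound_inf_mono[OF assms(1)])
  have "AE \<omega> in P s. W' n s \<omega> \<le> W n s \<omega>" if "n \<ge> 1" for n s
    using assms(3)[OF that] by eventually_elim simp
  then show "compound_inf P W' \<le> compound_inf P W"
    by (rule compound_inf_mono[OF assms(2)])
qed

lemma compound_inf_nonneg:
  assumes "\<And>n s. n \<ge> 1 \<Longrightarrow> AE \<omega> in P s. 0 \<le> W n s \<omega>"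
  shows "0 \<le> compound_inf P W"
proof (rule le_compound_infI)
  fix x assume x: "ereal x < 0"
  show "uniformly_null P (\<lambda>n s \<omega>. W n s \<omega> \<le> ereal x)"
  proof (rule uniformly_null_mono[where ?Q1.0 = "\<lambda>_ _ _. False"])
    fix n :: nat and s :: 's
    assume "n \<ge> 1"
    from assms[OF this]
    show "AE \<omega> in P s. W n s \<omega> \<le> ereal x \<longrightarrow> False"
      by eventually_elim (use x in \<open>metis leD order_trans\<close>)
  qed (auto simp: uniformly_null_def)
qed

text \<open>Otherwise a real threshold strictly between the two limits would make both
  \<open>W \<le> x\<close> and \<open>W \<ge> x\<close> uniformly null, though together they fill a
  space of probability 1.\<close>

lemma compound_inf_le_compound_sup:
  assumes "measurable_rate P W"
  shows "compound_inf P W \<le> compound_sup P W"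
proof (rule ccontr)
  assume "\<not> ?thesis"
  then obtain x where x: "ereal x < compound_inf P W" "compound_sup P W < ereal x"
    using ereal_dense2[of "compound_sup P W" "compound_inf P W"] by (auto simp: not_le)
  have 1: "uniformly_null P (\<lambda>n s \<omega>. W n s \<omega> \<le> ereal x)"
    using less_compound_infD[OF x(1) assms] .
  have "ereal (- x) < compound_inf P (\<lambda>n s \<omega>. - W n s \<omega>)"
    using x(2) unfolding compound_sup_eq_uminus_compound_inf
    by (simp add: ereal_uminus_less_reorder)
  from less_compound_infD[OF this measurable_rate_uminus[OF assms]]
  have 2: "uniformly_null P (\<lambda>n s \<omega>. - W n s \<omega> \<le> ereal (- x))" .
  have "uniformly_null P (\<lambda>n s \<omega>. True)"
    by (rule uniformly_null_disj[OF 1 2 sets_rate_le[OF assms]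
          sets_rate_le[OF measurable_rate_uminus[OF assms]]])
      (auto intro!: always_eventually
        simp: ereal_uminus_le_reorder[of _ "ereal _"])
  then show False using not_uniformly_null_True by simp
qed

text \<open>If \<open>x \<le> a + b\<close>, then \<open>A + B \<le> x\<close> forces
  \<open>A \<le> a\<close> or \<open>B \<le> b\<close>, and both are uniformly null for
  \<open>a\<close>, \<open>b\<close> below the respective limits. Excluding
  \<open>-\<infinity>\<close> guarantees that such real \<open>a\<close>, \<open>b\<close> exist; it
  also keeps out \<open>\<infinity> + -\<infinity>\<close>, which is \<open>\<infinity>\<close> in
  \<open>ereal\<close>.\<close>

lemma compound_inf_superadd:
  assumes "measurable_rate P A" and "measurable_rate P B"
    and "\<And>n s. n \<ge> 1 \<Longrightarrow> AE \<omega> in P s. C n s \<omega> = A n s \<omega> + B n s \<omega>"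
    and "compound_inf P A \<noteq> -\<infinity>" and "compound_inf P B \<noteq> -\<infinity>"
  shows "compound_inf P A + compound_inf P B \<le> compound_inf P C"
proof (rule le_compound_infI)
  fix x assume x: "ereal x < compound_inf P A + compound_inf P B"
  have "\<exists>a b. ereal a < compound_inf P A \<and> ereal b < compound_inf P B \<and> x \<le> a + b"
  proof (cases "compound_inf P A")
    case (real \<alpha>)
    show ?thesis
    proof (cases "compound_inf P B")
      case (real \<beta>)
      have "x < \<alpha> + \<beta>"
        using x real \<open>compound_inf P A = ereal \<alpha>\<close> by simp
      \<comment> \<open>Half of the slack \<open>\<alpha> + \<beta> - x\<close> is taken off each
        limit, so that the two thresholds add up to exactly \<open>x\<close>.\<close>
      then show ?thesis
        unfolding real \<open>compound_inf P A = ereal \<alpha>\<close>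
        by (intro exI[of _ "\<alpha> - (\<alpha> + \<beta> - x) / 2"] exI[of _ "\<beta> - (\<alpha> + \<beta> - x) / 2"])
          (simp add: field_simps)
    next
      case PInf
      show ?thesis
        unfolding PInf real by (intro exI[of _ "\<alpha> - 1"] exI[of _ "x - \<alpha> + 1"]) simp
    qed (use assms(5) in simp)
  next
    case PInf
    have "-\<infinity> < compound_inf P B"
      using assms(5) by simp
    then obtain b where "ereal b < compound_inf P B"
      using ereal_dense2 by blast
    then show ?thesis
      unfolding PInf by (intro exI[of _ "x - b"] exI[of _ b]) simp
  qed (use assms(4) in simp)
  then obtain a b where ab: "ereal a < compound_inf P A" "ereal b < compound_inf P B" "x \<le> a + b"
    by blast
  show "uniformly_null P (\<lambda>n s \<omega>. C n s \<omega> \<le> ereal x)"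
  proof (rule uniformly_null_disj[OF less_compound_infD[OF ab(1) assms(1)]
        less_compound_infD[OF ab(2) assms(2)] sets_rate_le[OF assms(1)] sets_rate_le[OF assms(2)]])
    fix n :: nat and s :: 's
    assume "n \<ge> 1"
    from assms(3)[OF this]
    show "AE \<omega> in P s. C n s \<omega> \<le> ereal x \<longrightarrow> A n s \<omega> \<le> ereal a \<or> B n s \<omega> \<le> ereal b"
    proof eventually_elim
      case (elim \<omega>)
      show ?case
      proof (intro impI, rule ccontr)
        assume *: "C n s \<omega> \<le> ereal x" "\<not> (A n s \<omega> \<le> ereal a \<or> B n s \<omega> \<le> ereal b)"
        have "ereal x \<le> ereal a + ereal b"
          using ab(3) by simp
        also have "\<dots> < A n s \<omega> + B n s \<omega>"
          using *(2) by (intro ereal_add_strict_mono2) auto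
        also have "\<dots> = C n s \<omega>"
          using elim by simp
        finally show False
          using *(1) by simp
      qed
    qed
  qed
qed

end

subsection \<open>Random elements with a density\<close>

text \<open>\<open>RN_deriv\<close> is a choice among densities and is meaningful only if one
  exists; the arbitrary density \<open>f\<close> witnesses this.\<close>

lemma distributed_RN_deriv_distr:
  assumes "distributed M N X f"
  shows "distributed M N X (RN_deriv N (distr M N X))"
  using assms by (auto simp: distributed_def intro!: RN_derivI[symmetric])

text \<open>The law of \<open>X\<close> gives no mass to the zero set of \<open>f\<close>, so the
  property is needed only where \<open>f\<close> is positive.\<close>

lemma distributed_AE:
  assumes "distributed M N X f" and "AE x in N. 0 < f x \<longrightarrow> Q x"
  shows "AE \<omega> in M. Q (X \<omega>)"
proof -
  have X: "X \<in> measurable M N"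
    using assms(1) by (simp add: distributed_def)
  have "AE x in density N f. Q x"
    using assms by (subst AE_density) (auto simp: distributed_def)
  then have "AE x in distr M N X. Q x"
    by (simp only: distributed_distr_eq_density[OF assms(1)])
  from AE_distrD[OF X this] show ?thesis .
qed

lemma (in prob_space) distributed_nn_integral_eq_1:
  assumes "distributed M N X f"
  shows "(\<integral>\<^sup>+x. f x \<partial>N) = 1"
  using distributed_nn_integral[OF assms, of "\<lambda>_. 1"] by (simp add: emeasure_space_1)

text \<open>Total integral 1 makes \<open>f\<close> finite almost everywhere, and the zero set of
  \<open>f\<close> carries no mass of the law. At the sample, \<open>ennreal\<close> arithmetic with
  densities thus becomes arithmetic of positive reals.\<close>

lemma (in prob_space) distributed_AE_pos_finite:
  assumes "distributed M N X f"
  shows "AE \<omega> in M. \<exists>r>0. f (X \<omega>) = ennreal r"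
proof (rule distributed_AE[OF assms])
  have "AE x in N. f x \<noteq> \<infinity>"
    using assms distributed_nn_integral_eq_1[OF assms]
    by (intro nn_integral_PInf_AE) (auto simp: distributed_def)
  then show "AE x in N. 0 < f x \<longrightarrow> (\<exists>r>0. f x = ennreal r)"
  proof eventually_elim
    case (elim x)
    then show ?case
      by (cases "f x") (auto simp: ennreal_less_zero_iff)
  qed
qed

text \<open>Change of measure: the probability is the integral of \<open>f\<close> over the set
  where \<open>f \<le> c * g\<close>, and there \<open>f\<close> may be replaced by
  \<open>c * g\<close>.\<close>

lemma (in prob_space) prob_density_le_mult:
  assumes X: "distributed M N X f" and g[measurable]: "g \<in> borel_measurable N"
    and le: "(\<integral>\<^sup>+x. g x \<partial>N) \<le> ennreal K" and "0 \<le> c" "0 \<le> K"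
  shows "\<P>(\<omega> in M. f (X \<omega>) \<le> ennreal c * g (X \<omega>)) \<le> c * K"
proof -
  have [measurable]: "f \<in> borel_measurable N" "X \<in> measurable M N"
    using X by (auto simp: distributed_def)
  let ?A = "{x \<in> space N. f x \<le> ennreal c * g x}"
  have "{\<omega> \<in> space M. f (X \<omega>) \<le> ennreal c * g (X \<omega>)} = X -` ?A \<inter> space M"
    using measurable_space[of X M N] by auto
  then have "emeasure M {\<omega> \<in> space M. f (X \<omega>) \<le> ennreal c * g (X \<omega>)} =
      (\<integral>\<^sup>+x. f x * indicator ?A x \<partial>N)"
    using distributed_emeasure[OF X, of ?A] by (simp del: vimage_Collect_eq)
  also have "\<dots> \<le> (\<integral>\<^sup>+x. ennreal c * g x \<partial>N)"
    by (intro nn_integral_mono) (auto simp: indicator_def)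
  also have "\<dots> = ennreal c * (\<integral>\<^sup>+x. g x \<partial>N)"
    by (intro nn_integral_cmult) auto
  also have "\<dots> \<le> ennreal (c * K)"
    using le assms(4,5) by (simp add: ennreal_mult mult_left_mono)
  finally show ?thesis
    using assms(4,5) by (simp add: emeasure_eq_measure)
qed

lemma distributed_count_space_countable:
  assumes "distributed M (count_space A) X f" and "a \<in> A"
  shows "f a = emeasure M (X -` {a} \<inter> space M)"
  using distributed_emeasure[OF assms(1), of "{a}"] assms(2)
  by (simp add: nn_integral_indicator_singleton)

text \<open>By Tonelli's theorem the middle coordinate can be integrated first; sigma-finiteness
  reduces the verification to rectangles.\<close>

lemma (in prob_space) distributed_drop_middle:
  assumes S: "sigma_finite_measure S" and T: "sigma_finite_measure T" and U: "sigma_finite_measure U"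
    and F: "distributed M ((S \<Otimes>\<^sub>M T) \<Otimes>\<^sub>M U) (\<lambda>\<omega>. ((X \<omega>, Y \<omega>), Z \<omega>)) F"
  shows "distributed M (S \<Otimes>\<^sub>M U) (\<lambda>\<omega>. (X \<omega>, Z \<omega>)) (\<lambda>(x, z). \<integral>\<^sup>+y. F ((x, y), z) \<partial>T)"
proof (rule distributed_jointI[OF S U])
  interpret S: sigma_finite_measure S by fact
  interpret T: sigma_finite_measure T by fact
  interpret U: sigma_finite_measure U by fact
  interpret ST: pair_sigma_finite S T ..
  interpret TU: pair_sigma_finite T U ..
  interpret STU: pair_sigma_finite "S \<Otimes>\<^sub>M T" U ..
  have F'[measurable]: "F \<in> borel_measurable ((S \<Otimes>\<^sub>M T) \<Otimes>\<^sub>M U)"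
    using F by (simp add: distributed_def)
  have XYZ[measurable]: "(\<lambda>\<omega>. ((X \<omega>, Y \<omega>), Z \<omega>)) \<in> measurable M ((S \<Otimes>\<^sub>M T) \<Otimes>\<^sub>M U)"
    using F by (simp add: distributed_def)
  show X[measurable]: "X \<in> measurable M S"
    using measurable_compose[OF XYZ, of "\<lambda>p. fst (fst p)" S] by simp
  show Z[measurable]: "Z \<in> measurable M U"
    using measurable_compose[OF XYZ, of snd U] by simp
  show "(\<lambda>(x, z). \<integral>\<^sup>+y. F ((x, y), z) \<partial>T) \<in> borel_measurable (S \<Otimes>\<^sub>M U)"
    by measurable
  fix A B
  assume [measurable]: "A \<in> sets S" "B \<in> sets U"
  \<comment> \<open>\<open>Y\<close> is left unconstrained, so the event is the preimage of a
    cylinder over all of \<open>T\<close>.\<close>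
  have "emeasure M {\<omega> \<in> space M. X \<omega> \<in> A \<and> Z \<omega> \<in> B} =
      emeasure M ((\<lambda>\<omega>. ((X \<omega>, Y \<omega>), Z \<omega>)) -` ((A \<times> space T) \<times> B) \<inter> space M)"
    using measurable_space[OF XYZ] by (intro arg_cong[where f = "emeasure M"]) (auto simp: space_pair_measure)
  also have "\<dots> = (\<integral>\<^sup>+p. F p * indicator ((A \<times> space T) \<times> B) p \<partial>((S \<Otimes>\<^sub>M T) \<Otimes>\<^sub>M U))"
    by (intro distributed_emeasure[OF F]) measurable
  also have "\<dots> = (\<integral>\<^sup>+q. \<integral>\<^sup>+z. F (q, z) * indicator ((A \<times> space T) \<times> B) (q, z) \<partial>U \<partial>(S \<Otimes>\<^sub>M T))"
    by (intro U.nn_integral_fst[symmetric]) measurable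
  also have "\<dots> = (\<integral>\<^sup>+x. \<integral>\<^sup>+y. \<integral>\<^sup>+z. F ((x, y), z) * indicator ((A \<times> space T) \<times> B) ((x, y), z) \<partial>U \<partial>T \<partial>S)"
    by (intro T.nn_integral_fst[symmetric]) measurable
  also have "\<dots> = (\<integral>\<^sup>+x. \<integral>\<^sup>+z. \<integral>\<^sup>+y. F ((x, y), z) * indicator ((A \<times> space T) \<times> B) ((x, y), z) \<partial>T \<partial>U \<partial>S)"
    by (intro nn_integral_cong TU.Fubini'[symmetric]) measurable
  also have "\<dots> = (\<integral>\<^sup>+x. \<integral>\<^sup>+z. (\<integral>\<^sup>+y. F ((x, y), z) \<partial>T) * indicator B z * indicator A x \<partial>U \<partial>S)"
  proof (intro nn_integral_cong)
    fix x z assume "x \<in> space S" "z \<in> space U"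
    then have [measurable]: "(\<lambda>y. F ((x, y), z)) \<in> borel_measurable T" by measurable
    have "(\<integral>\<^sup>+y. F ((x, y), z) * indicator ((A \<times> space T) \<times> B) ((x, y), z) \<partial>T) =
        (\<integral>\<^sup>+y. F ((x, y), z) * (indicator B z * indicator A x) \<partial>T)"
      by (intro nn_integral_cong) (auto simp: indicator_def)
    then show "(\<integral>\<^sup>+y. F ((x, y), z) * indicator ((A \<times> space T) \<times> B) ((x, y), z) \<partial>T) =
        (\<integral>\<^sup>+y. F ((x, y), z) \<partial>T) * indicator B z * indicator A x"
      by (simp add: nn_integral_multc mult.assoc)
  qed
  also have "\<dots> = (\<integral>\<^sup>+x. (\<integral>\<^sup>+z. (\<integral>\<^sup>+y. F ((x, y), z) \<partial>T) * indicator B z \<partial>U) * indicator A x \<partial>S)"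
    by (intro nn_integral_cong nn_integral_multc) measurable
  finally show "emeasure M {\<omega> \<in> space M. X \<omega> \<in> A \<and> Z \<omega> \<in> B} =
      (\<integral>\<^sup>+x. (\<integral>\<^sup>+z. (case (x, z) of (x, z) \<Rightarrow> \<integral>\<^sup>+y. F ((x, y), z) \<partial>T) * indicator B z \<partial>U) * indicator A x \<partial>S)"
    by simp
qed auto

section \<open>The extended logarithm and threshold events of likelihood ratios\<close>

lemma ln_ext_ennreal: "0 < r \<Longrightarrow> ln_ext (ennreal r) = ereal (ln r)"
  by (simp add: ln_ext_def ennreal_eq_0_iff)

lemma measurable_ln_ext[measurable]: "ln_ext \<in> borel_measurable borel"
  unfolding ln_ext_def[abs_def] by measurable

text \<open>Exponentiation of the threshold. The value \<open>r = 0\<close> is harmless, and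
  \<open>r = \<infinity>\<close> cannot occur: as \<open>1 / n\<close> is positive, the rate would
  be \<open>\<infinity>\<close>.\<close>

lemma le_exp_of_rate_le:
  assumes "n \<ge> 1" and "ereal (1 / real n) * ln_ext r \<le> ereal x"
  shows "r \<le> ennreal (exp (real n * x))"
proof (cases r)
  case (real t)
  show ?thesis
  proof (cases "t = 0")
    case False
    with real have "0 < t" by simp
    with real assms have "ln t \<le> real n * x"
      by (simp add: ln_ext_ennreal field_simps)
    with \<open>0 < t\<close> have "t \<le> exp (real n * x)"
      by (metis exp_le_cancel_iff exp_ln)
    with real show ?thesis by (simp add: ennreal_leI)
  qed (simp add: real)
next
  case top
  with assms show ?thesis by (simp add: ln_ext_def)
qed

text \<open>Clearing a denominator in \<open>ennreal\<close>: for \<open>b = 0\<close> the finite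
  bound forces \<open>a = 0\<close>, and for \<open>b = \<infinity>\<close> the right side is
  \<open>\<infinity>\<close> because \<open>c\<close> is positive.\<close>

lemma le_mult_of_divide_le_ennreal:
  assumes "a / b \<le> ennreal c" and "0 < c"
  shows "a \<le> ennreal c * b"
proof (cases "b = 0 \<or> b = top")
  case True
  with assms show ?thesis
    by (auto simp: ennreal_mult_top top_unique split: if_splits)
next
  case False
  then have "a = a / b * b"
    by (metis mult_divide_eq_ennreal ennreal_divide_times ennreal_times_divide mult.commute)
  also have "\<dots> \<le> ennreal c * b"
    using assms by (intro mult_right_mono) auto
  finally show ?thesis .
qed

subsection \<open>Densities at the sample\<close>

definition sigma_finite_ref :: "('w, 'v) rseq \<Rightarrow> bool" where
  "sigma_finite_ref V \<longleftrightarrow> (\<forall>n\<ge>1. sigma_finite_measure (ref V n))"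

lemma sigma_finite_ref_vector:
  assumes "sigma_finite_measure M" and "vector_rseq M V"
  shows "sigma_finite_ref V"
proof -
  interpret product_sigma_finite "\<lambda>_. M"
    using assms(1) by (simp add: product_sigma_finite_def)
  show ?thesis
    using assms(2) sigma_finite[OF finite_lessThan] by (simp add: sigma_finite_ref_def vector_rseq_def)
qed

lemma sigma_finite_ref_joint:
  "sigma_finite_ref U \<Longrightarrow> sigma_finite_ref V \<Longrightarrow> sigma_finite_ref (joint U V)"
  by (auto simp: sigma_finite_ref_def joint_def intro!: sigma_finite_pair_measure)

text \<open>Unlike the existential \<open>has_density\<close>, this speaks of the particular version
  \<open>dens\<close> that enters the rates; the two are equivalent by
  \<open>distributed_RN_deriv_distr\<close>.\<close>

definition has_dens :: "('s \<Rightarrow> 'w measure) \<Rightarrow> ('w, 'v) rseq \<Rightarrow> bool" where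
  "has_dens P V \<longleftrightarrow> (\<forall>n\<ge>1. \<forall>s. distributed (P s) (ref V n) (rv V n) (dens P V n s))"

lemma has_densD:
  "has_dens P V \<Longrightarrow> n \<ge> 1 \<Longrightarrow> distributed (P s) (ref V n) (rv V n) (dens P V n s)"
  by (simp add: has_dens_def)

lemma has_dens_iff_has_density: "has_dens P V \<longleftrightarrow> has_density P V"
  unfolding has_dens_def has_density_def dens_def
  by (blast intro: distributed_RN_deriv_distr)

lemma has_densI:
  "(\<And>n s. n \<ge> 1 \<Longrightarrow> distributed (P s) (ref V n) (rv V n) (f n s)) \<Longrightarrow> has_dens P V"
  unfolding has_dens_iff_has_density has_density_def by blast

lemma ref_joint: "ref (joint U V) n = ref U n \<Otimes>\<^sub>M ref V n"
  and rv_joint: "rv (joint U V) n = (\<lambda>\<omega>. (rv U n \<omega>, rv V n \<omega>))"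
  by (simp_all add: joint_def)

abbreviation sample_dens ::
  "('s \<Rightarrow> 'w measure) \<Rightarrow> ('w, 'v) rseq \<Rightarrow> nat \<Rightarrow> 's \<Rightarrow> 'w \<Rightarrow> ennreal" where
  "sample_dens P V n s \<omega> \<equiv> dens P V n s (rv V n \<omega>)"

lemma info_rate_eq:
  "info_rate P U V n s \<omega> = ereal (1 / real n) *
    ln_ext (sample_dens P (joint U V) n s \<omega> / (sample_dens P U n s \<omega> * sample_dens P V n s \<omega>))"
  by (simp add: info_rate_def rv_joint)

lemma cond_ent_rate_eq:
  "cond_ent_rate P V U n s \<omega> =
    - (ereal (1 / real n) * ln_ext (sample_dens P (joint U V) n s \<omega> / sample_dens P U n s \<omega>))"
  by (simp add: cond_ent_rate_def cond_dens_def rv_joint)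

lemma pair_info_rate_eq:
  "pair_info_rate P U V W n s \<omega> = ereal (1 / real n) *
    ln_ext (sample_dens P (joint (joint U V) W) n s \<omega> / sample_dens P (joint U V) n s \<omega> /
      sample_dens P W n s \<omega>)"
  by (simp add: pair_info_rate_def cond_dens_def rv_joint)

lemma cond_info_rate_eq:
  "cond_info_rate P V W U n s \<omega> = ereal (1 / real n) *
    ln_ext (sample_dens P (joint (joint U V) W) n s \<omega> / sample_dens P (joint U V) n s \<omega> /
      (sample_dens P (joint U W) n s \<omega> / sample_dens P U n s \<omega>))"
  by (simp add: cond_info_rate_def cond_dens_def rv_joint)

lemma measurable_sample_dens:
  assumes "has_dens P V" "n \<ge> 1"
  shows "sample_dens P V n s \<in> borel_measurable (P s)"
  using has_densD[OF assms, of s] by (auto simp: distributed_def intro: measurable_compose)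

lemma measurable_ent_rate: "has_dens P V \<Longrightarrow> measurable_rate P (ent_rate P V)"
  unfolding measurable_rate_def ent_rate_def[abs_def]
  using measurable_sample_dens[of P V, measurable] by simp

lemma measurable_info_rate:
  "has_dens P (joint U V) \<Longrightarrow> has_dens P U \<Longrightarrow> has_dens P V \<Longrightarrow> measurable_rate P (info_rate P U V)"
  unfolding measurable_rate_def info_rate_eq[abs_def]
  using measurable_sample_dens[of P U, measurable] measurable_sample_dens[of P V, measurable]
    measurable_sample_dens[of P "joint U V", measurable] by simp

lemma measurable_cond_ent_rate:
  "has_dens P (joint U V) \<Longrightarrow> has_dens P U \<Longrightarrow> measurable_rate P (cond_ent_rate P V U)"
  unfolding measurable_rate_def cond_ent_rate_eq[abs_def]
  using measurable_sample_dens[of P U, measurable]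
    measurable_sample_dens[of P "joint U V", measurable] by simp

lemma measurable_pair_info_rate:
  "has_dens P (joint (joint U V) W) \<Longrightarrow> has_dens P (joint U V) \<Longrightarrow> has_dens P W \<Longrightarrow>
    measurable_rate P (pair_info_rate P U V W)"
  unfolding measurable_rate_def pair_info_rate_eq[abs_def]
  using measurable_sample_dens[of P W, measurable]
    measurable_sample_dens[of P "joint U V", measurable]
    measurable_sample_dens[of P "joint (joint U V) W", measurable] by simp

lemma measurable_cond_info_rate:
  "has_dens P (joint (joint U V) W) \<Longrightarrow> has_dens P (joint U V) \<Longrightarrow> has_dens P (joint U W) \<Longrightarrow>
    has_dens P U \<Longrightarrow> measurable_rate P (cond_info_rate P V W U)"
  unfolding measurable_rate_def cond_info_rate_eq[abs_def]
  using measurable_sample_dens[of P U, measurable]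
    measurable_sample_dens[of P "joint U V", measurable]
    measurable_sample_dens[of P "joint U W", measurable]
    measurable_sample_dens[of P "joint (joint U V) W", measurable] by simp

context compound_space
begin

lemma sample_dens_pos_finite:
  assumes "has_dens P V" "n \<ge> 1"
  shows "AE \<omega> in P s. \<exists>r>0. sample_dens P V n s \<omega> = ennreal r"
  by (rule prob_space.distributed_AE_pos_finite[OF prob_space_P has_densD[OF assms]])

text \<open>Two densities of one law agree almost everywhere in the reference measure, and the law
  is absolutely continuous to it, so they agree almost surely at the sample.\<close>

lemma sample_dens_unique:
  assumes "has_dens P V" "n \<ge> 1" and "distributed (P s) (ref V n) (rv V n) f"
  shows "AE \<omega> in P s. sample_dens P V n s \<omega> = f (rv V n \<omega>)"
proof -
  have "AE x in ref V n. dens P V n s x = f x"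
    by (rule prob_space.distributed_unique[OF prob_space_P has_densD[OF assms(1,2)] assms(3)])
  then have "AE x in ref V n. 0 < f x \<longrightarrow> dens P V n s x = f x"
    by eventually_elim simp
  from distributed_AE[OF assms(3) this] show ?thesis .
qed

lemma has_dens_fst:
  assumes "has_dens P (joint U V)" "sigma_finite_ref U" "sigma_finite_ref V"
  shows "has_dens P U"
proof (rule has_densI)
  fix n :: nat and s :: 's
  assume n: "n \<ge> 1"
  interpret prob_space "P s" by (rule prob_space_P)
  show "distributed (P s) (ref U n) (rv U n) (\<lambda>x. \<integral>\<^sup>+z. dens P (joint U V) n s (x, z) \<partial>ref V n)"
    using assms(2,3) n has_densD[OF assms(1) n, of s]
    by (intro distr_marginal1) (auto simp: sigma_finite_ref_def ref_joint rv_joint)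
qed

lemma distributed_joint_swap:
  assumes "has_dens P (joint U V)" "sigma_finite_ref U" "sigma_finite_ref V" "n \<ge> 1"
  shows "distributed (P s) (ref (joint V U) n) (rv (joint V U) n)
    (\<lambda>(y, x). dens P (joint U V) n s (x, y))"
proof -
  interpret prob_space "P s" by (rule prob_space_P)
  show ?thesis
    unfolding ref_joint rv_joint using assms(2-) has_densD[OF assms(1,4), of s]
    by (intro distributed_swap) (auto simp: sigma_finite_ref_def ref_joint rv_joint)
qed

lemma has_dens_swap:
  assumes "has_dens P (joint U V)" "sigma_finite_ref U" "sigma_finite_ref V"
  shows "has_dens P (joint V U)"
  by (rule has_densI[OF distributed_joint_swap[OF assms]])

lemma has_dens_snd:
  assumes "has_dens P (joint U V)" "sigma_finite_ref U" "sigma_finite_ref V"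
  shows "has_dens P V"
  by (rule has_dens_fst[OF has_dens_swap[OF assms] assms(3,2)])

text \<open>\<open>dens\<close> chooses its versions for the two orders independently, so they match
  only up to null sets, which the sample avoids almost surely.\<close>

lemma sample_dens_swap:
  assumes "has_dens P (joint U V)" "sigma_finite_ref U" "sigma_finite_ref V" "n \<ge> 1"
  shows "AE \<omega> in P s. sample_dens P (joint V U) n s \<omega> = sample_dens P (joint U V) n s \<omega>"
  using sample_dens_unique[OF has_dens_swap[OF assms(1-3)] assms(4) distributed_joint_swap[OF assms]]
  by (simp add: rv_joint)

text \<open>Conditional information given the first component involves p(x,z), while the density
  supplied is that of the whole triple.\<close>

lemma has_dens_drop_middle:
  assumes "has_dens P (joint (joint U V) W)"
    and "sigma_finite_ref U" "sigma_finite_ref V" "sigma_finite_ref W"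
  shows "has_dens P (joint U W)"
proof (rule has_densI)
  fix n :: nat and s :: 's
  assume n: "n \<ge> 1"
  interpret prob_space "P s" by (rule prob_space_P)
  show "distributed (P s) (ref (joint U W) n) (rv (joint U W) n)
      (\<lambda>(x, z). \<integral>\<^sup>+y. dens P (joint (joint U V) W) n s ((x, y), z) \<partial>ref V n)"
    unfolding ref_joint rv_joint
    using assms(2-4) n has_densD[OF assms(1) n, of s]
    by (intro distributed_drop_middle[where Y = "rv V n"])
      (auto simp: sigma_finite_ref_def ref_joint rv_joint)
qed

text \<open>
  The factor \<open>K\<close> serves two purposes: \<open>K = 1\<close> for the nonnegativity of divergence and information
  rates, and \<open>K\<close> the alphabet size, with \<open>G = 1\<close>, for the bound on the entropy of a finite alphabet.
\<close>

lemma compound_inf_ln_ratio_ge: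
  assumes V: "has_dens P V" and "0 < K"
    and G: "\<And>n s. n \<ge> 1 \<Longrightarrow> G n s \<in> borel_measurable (ref V n)"
    and le: "\<And>n s. n \<ge> 1 \<Longrightarrow> (\<integral>\<^sup>+v. G n s v \<partial>ref V n) \<le> ennreal (K ^ n)"
  shows "ereal (- ln K) \<le> compound_inf P (\<lambda>n s \<omega>.
    ereal (1 / real n) * ln_ext (sample_dens P V n s \<omega> / G n s (rv V n \<omega>)))"
proof (rule le_compound_infI, rule uniformly_nullI_bound)
  fix x n and s :: 's
  assume n: "1 \<le> (n::nat)"
  interpret prob_space "P s" by (rule prob_space_P)
  let ?c = "exp (real n * x)"
  have meas: "{\<omega> \<in> space (P s). sample_dens P V n s \<omega> \<le> ennreal ?c * G n s (rv V n \<omega>)} \<in> sets (P s)"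
  proof -
    have "rv V n \<in> measurable (P s) (ref V n)"
      using has_densD[OF V n, of s] by (simp add: distributed_def)
    from measurable_compose[OF this G[OF n, of s]] measurable_sample_dens[OF V n, of s]
    show ?thesis by measurable
  qed
  \<comment> \<open>An inclusion of events: a rate of at most \<open>x\<close> bounds the ratio by
    \<open>exp (n * x)\<close>, and clearing the denominator turns this into a comparison with
    \<open>G\<close>.\<close>
  have "\<P>(\<omega> in P s. ereal (1 / real n) * ln_ext (sample_dens P V n s \<omega> / G n s (rv V n \<omega>)) \<le> ereal x)
      \<le> \<P>(\<omega> in P s. sample_dens P V n s \<omega> \<le> ennreal ?c * G n s (rv V n \<omega>))"
    by (intro finite_measure_mono meas)
      (auto intro!: le_mult_of_divide_le_ennreal dest!: le_exp_of_rate_le[OF n])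
  also have "\<dots> \<le> ?c * K ^ n"
    using \<open>0 < K\<close> by (intro prob_density_le_mult[OF has_densD[OF V n]] G le n) auto
  also have "\<dots> = (exp x * K) ^ n"
    by (simp add: exp_of_nat_mult power_mult_distrib)
  finally show "\<P>(\<omega> in P s. ereal (1 / real n) *
      ln_ext (sample_dens P V n s \<omega> / G n s (rv V n \<omega>)) \<le> ereal x) \<le> (exp x * K) ^ n" .
next
  \<comment> \<open>Strictly below \<open>- ln K\<close> the base \<open>exp x * K\<close> is less
    than 1, so the bound, which is free of the state, decays geometrically.\<close>
  fix x assume "ereal x < ereal (- ln K)"
  then have "exp (x + ln K) < 1" by simp
  then have "exp x * K < 1"
    using \<open>0 < K\<close> by (simp add: exp_add)
  then show "(\<lambda>n. (exp x * K) ^ n) \<longlonglongrightarrow> 0"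
    using \<open>0 < K\<close> by (intro LIMSEQ_realpow_zero) auto
qed

section \<open>Nonnegativity of divergence and information rates\<close>

text \<open>The density of \<open>V'\<close> integrates to 1 and serves as \<open>G\<close> with
  \<open>K = 1\<close>. Equal reference measures make this a ratio of two densities on one
  space.\<close>

lemma inf_D_nonneg:
  assumes "has_dens P V" "has_dens P V'" "\<And>n. n \<ge> 1 \<Longrightarrow> ref V' n = ref V n"
  shows "0 \<le> inf_D P V V'"
proof -
  have "ereal (- ln 1) \<le> compound_inf P (\<lambda>n s \<omega>.
      ereal (1 / real n) * ln_ext (sample_dens P V n s \<omega> / dens P V' n s (rv V n \<omega>)))"
  proof (rule compound_inf_ln_ratio_ge[OF assms(1)])
    fix n :: nat and s :: 's
    assume n: "n \<ge> 1"
    have "distributed (P s) (ref V n) (rv V' n) (dens P V' n s)"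
      using has_densD[OF assms(2) n, of s] assms(3)[OF n] by simp
    then show "dens P V' n s \<in> borel_measurable (ref V n)"
      "(\<integral>\<^sup>+v. dens P V' n s v \<partial>ref V n) \<le> ennreal (1 ^ n)"
      by (simp_all add: distributed_borel_measurable
          prob_space.distributed_nn_integral_eq_1[OF prob_space_P])
  qed simp
  then show ?thesis
    by (simp add: inf_D_def div_rate_def[abs_def] flip: zero_ereal_def)
qed

text \<open>\<open>G\<close> is the density of the product of the marginal laws, that is, of an
  independent pair; Tonelli gives it integral 1.\<close>

lemma inf_I_nonneg:
  assumes "has_dens P (joint U V)" "has_dens P U" "has_dens P V" "sigma_finite_ref V"
  shows "0 \<le> inf_I P U V"
proof -
  have "ereal (- ln 1) \<le> compound_inf P (\<lambda>n s \<omega>. ereal (1 / real n) *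
      ln_ext (sample_dens P (joint U V) n s \<omega> /
        (\<lambda>(x, y). dens P U n s x * dens P V n s y) (rv (joint U V) n \<omega>)))"
  proof (rule compound_inf_ln_ratio_ge[OF assms(1)])
    fix n :: nat and s :: 's
    assume n: "n \<ge> 1"
    interpret prob_space "P s" by (rule prob_space_P)
    interpret V: sigma_finite_measure "ref V n"
      using assms(4) n by (simp add: sigma_finite_ref_def)
    note UV = has_densD[OF assms(2) n, of s] has_densD[OF assms(3) n, of s]
    have [measurable]: "dens P U n s \<in> borel_measurable (ref U n)" "dens P V n s \<in> borel_measurable (ref V n)"
      using UV by (auto simp: distributed_def)
    show "(\<lambda>(x, y). dens P U n s x * dens P V n s y) \<in> borel_measurable (ref (joint U V) n)"
      unfolding ref_joint by measurable
    have "(\<integral>\<^sup>+p. (\<lambda>(x, y). dens P U n s x * dens P V n s y) p \<partial>ref (joint U V) n) =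
        (\<integral>\<^sup>+x. \<integral>\<^sup>+y. dens P U n s x * dens P V n s y \<partial>ref V n \<partial>ref U n)"
      unfolding ref_joint by (subst V.nn_integral_fst[symmetric]) auto
    also have "\<dots> = 1"
      using distributed_nn_integral_eq_1[OF UV(1)] distributed_nn_integral_eq_1[OF UV(2)]
      by (simp add: nn_integral_cmult)
    finally show "(\<integral>\<^sup>+p. (\<lambda>(x, y). dens P U n s x * dens P V n s y) p \<partial>ref (joint U V) n) \<le> ennreal (1 ^ n)"
      by simp
  qed simp
  then show ?thesis
    by (simp add: inf_I_def info_rate_eq[abs_def] rv_joint flip: zero_ereal_def)
qed

text \<open>\<open>G\<close> is p(x,y) p(z|x), under which y and z are conditionally independent
  given x. Integrating out z leaves p(x,y) p(x) / p(x), which is at most p(x,y).\<close>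

lemma inf_I_cond_nonneg:
  assumes UVW: "has_dens P (joint (joint U V) W)" and UV: "has_dens P (joint U V)"
    and UW: "has_dens P (joint U W)" and U: "has_dens P U"
    and sf: "sigma_finite_ref U" "sigma_finite_ref V" "sigma_finite_ref W"
  shows "0 \<le> inf_I_cond P V W U"
proof -
  let ?G = "\<lambda>n s p. dens P (joint U V) n s (fst p) *
      (dens P (joint U W) n s (fst (fst p), snd p) / dens P U n s (fst (fst p)))"
  let ?W = "\<lambda>n s \<omega>. ereal (1 / real n) *
      ln_ext (sample_dens P (joint (joint U V) W) n s \<omega> / ?G n s (rv (joint (joint U V) W) n \<omega>))"
  have G_meas: "?G n s \<in> borel_measurable (ref (joint (joint U V) W) n)" if n: "n \<ge> 1" for n s
  proof -
    have [measurable]: "dens P U n s \<in> borel_measurable (ref U n)"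
      "dens P (joint U V) n s \<in> borel_measurable (ref U n \<Otimes>\<^sub>M ref V n)"
      "dens P (joint U W) n s \<in> borel_measurable (ref U n \<Otimes>\<^sub>M ref W n)"
      using has_densD[OF U n, of s] has_densD[OF UV n, of s] has_densD[OF UW n, of s]
      by (auto simp: distributed_def ref_joint)
    show ?thesis
      unfolding ref_joint by measurable
  qed
  have "ereal (- ln 1) \<le> compound_inf P ?W"
  proof (rule compound_inf_ln_ratio_ge[OF UVW _ G_meas])
    fix n :: nat and s :: 's
    assume n: "n \<ge> 1"
    interpret prob_space "P s" by (rule prob_space_P)
    interpret U: sigma_finite_measure "ref U n"
      using sf n by (simp add: sigma_finite_ref_def)
    interpret V: sigma_finite_measure "ref V n"
      using sf n by (simp add: sigma_finite_ref_def)
    interpret W: sigma_finite_measure "ref W n"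
      using sf n by (simp add: sigma_finite_ref_def)
    have [measurable]: "dens P U n s \<in> borel_measurable (ref U n)"
      "dens P (joint U V) n s \<in> borel_measurable (ref U n \<Otimes>\<^sub>M ref V n)"
      "dens P (joint U W) n s \<in> borel_measurable (ref U n \<Otimes>\<^sub>M ref W n)"
      using has_densD[OF U n, of s] has_densD[OF UV n, of s] has_densD[OF UW n, of s]
      by (auto simp: distributed_def ref_joint)
    \<comment> \<open>\<open>dens P U n s\<close> is a separately chosen version, so the marginal
      identity holds only almost everywhere.\<close>
    have marginal: "AE x in ref U n. dens P U n s x = (\<integral>\<^sup>+z. dens P (joint U W) n s (x, z) \<partial>ref W n)"
      using has_densD[OF U n, of s] has_densD[OF UW n, of s]
      by (intro distributed_marginal_eq_joint1[where X = "rv U n" and Y = "rv W n"])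
        (auto simp: ref_joint rv_joint U.sigma_finite_measure_axioms W.sigma_finite_measure_axioms)
    have "(\<integral>\<^sup>+p. ?G n s p \<partial>ref (joint (joint U V) W) n) =
        (\<integral>\<^sup>+q. \<integral>\<^sup>+z. ?G n s (q, z) \<partial>ref W n \<partial>(ref U n \<Otimes>\<^sub>M ref V n))"
      unfolding ref_joint by (intro W.nn_integral_fst[symmetric]) measurable
    also have "\<dots> = (\<integral>\<^sup>+x. \<integral>\<^sup>+y. \<integral>\<^sup>+z. ?G n s ((x, y), z) \<partial>ref W n \<partial>ref V n \<partial>ref U n)"
      by (intro V.nn_integral_fst[symmetric]) measurable
    also have "\<dots> \<le> (\<integral>\<^sup>+x. \<integral>\<^sup>+y. dens P (joint U V) n s (x, y) \<partial>ref V n \<partial>ref U n)"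
    proof (rule nn_integral_mono_AE)
      from marginal AE_space
      show "AE x in ref U n. (\<integral>\<^sup>+y. \<integral>\<^sup>+z. ?G n s ((x, y), z) \<partial>ref W n \<partial>ref V n) \<le>
          (\<integral>\<^sup>+y. dens P (joint U V) n s (x, y) \<partial>ref V n)"
      proof (eventually_elim, intro nn_integral_mono)
        fix x y
        assume eq: "dens P U n s x = (\<integral>\<^sup>+z. dens P (joint U W) n s (x, z) \<partial>ref W n)"
          and x: "x \<in> space (ref U n)"
        have [measurable]: "(\<lambda>z. dens P (joint U W) n s (x, z)) \<in> borel_measurable (ref W n)"
          using x by measurable
        have "(\<integral>\<^sup>+z. ?G n s ((x, y), z) \<partial>ref W n) =
            dens P (joint U V) n s (x, y) * (dens P U n s x / dens P U n s x)"
          by (simp add: nn_integral_cmult nn_integral_divide eq)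
        also have "\<dots> \<le> dens P (joint U V) n s (x, y) * 1"
        proof (intro mult_left_mono)
          \<comment> \<open>In \<open>ennreal\<close> this quotient is 0, not 1, when the density is
            0 or \<open>\<infinity>\<close>; hence an inequality.\<close>
          show "dens P U n s x / dens P U n s x \<le> 1"
            by (cases "dens P U n s x = 0 \<or> dens P U n s x = top") (auto simp: less_top)
        qed simp
        finally show "(\<integral>\<^sup>+z. ?G n s ((x, y), z) \<partial>ref W n) \<le> dens P (joint U V) n s (x, y)"
          by simp
      qed
    qed
    also have "\<dots> = (\<integral>\<^sup>+p. dens P (joint U V) n s p \<partial>ref (joint U V) n)"
      unfolding ref_joint by (intro V.nn_integral_fst) measurable
    also have "\<dots> = 1"
      by (rule distributed_nn_integral_eq_1[OF has_densD[OF UV n]])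
    finally show "(\<integral>\<^sup>+p. ?G n s p \<partial>ref (joint (joint U V) W) n) \<le> ennreal (1 ^ n)"
      by simp
  qed simp_all
  \<comment> \<open>\<open>?W\<close> divides once by the whole product,
    \<open>cond_info_rate\<close> in two stages. In \<open>ennreal\<close> these may differ at
    degenerate values, so they are matched where all four densities are positive reals.\<close>
  also have "compound_inf P ?W = inf_I_cond P V W U"
    unfolding inf_I_cond_def
  proof (rule compound_inf_cong)
    show "measurable_rate P (cond_info_rate P V W U)"
      by (rule measurable_cond_info_rate[OF UVW UV UW U])
    show "measurable_rate P ?W"
      unfolding measurable_rate_def
    proof (intro allI impI)
      fix n :: nat and s :: 's
      assume n: "n \<ge> 1"
      have [measurable]: "(\<lambda>\<omega>. ?G n s (rv (joint (joint U V) W) n \<omega>)) \<in> borel_measurable (P s)"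
        using has_densD[OF UVW n, of s]
        by (intro measurable_compose[OF _ G_meas[OF n]]) (simp add: distributed_def)
      show "?W n s \<in> borel_measurable (P s)"
        using measurable_sample_dens[OF UVW n, of s] by measurable
    qed
    fix n :: nat and s :: 's
    assume n: "n \<ge> 1"
    from sample_dens_pos_finite[OF UVW n, of s] sample_dens_pos_finite[OF UV n, of s]
      sample_dens_pos_finite[OF UW n, of s] sample_dens_pos_finite[OF U n, of s]
    show "AE \<omega> in P s. ?W n s \<omega> = cond_info_rate P V W U n s \<omega>"
    proof eventually_elim
      case (elim \<omega>)
      then obtain a b c d where "a > 0" "b > 0" "c > 0" "d > 0"
        "sample_dens P (joint (joint U V) W) n s \<omega> = ennreal a"
        "sample_dens P (joint U V) n s \<omega> = ennreal b"
        "sample_dens P (joint U W) n s \<omega> = ennreal c"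
        "sample_dens P U n s \<omega> = ennreal d"
        by auto
      then show ?case
        by (simp add: cond_info_rate_eq rv_joint divide_ennreal ennreal_mult[symmetric] field_simps)
    qed
  qed
  finally show ?thesis
    by (simp flip: zero_ereal_def)
qed

text \<open>The numerators for the two orders agree almost surely at the sample, and the denominator
  is a commutative product.\<close>

lemma inf_I_sym:
  assumes UV: "has_dens P (joint U V)" and sf: "sigma_finite_ref U" "sigma_finite_ref V"
  shows "inf_I P U V = inf_I P V U" "sup_I P U V = sup_I P V U"
proof -
  note VU = has_dens_swap[OF assms]
  note U = has_dens_fst[OF assms] and V = has_dens_snd[OF assms]
  note meas = measurable_info_rate[OF UV U V] measurable_info_rate[OF VU V U]
  have eq: "AE \<omega> in P s. info_rate P U V n s \<omega> = info_rate P V U n s \<omega>" if n: "n \<ge> 1" for n s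
    using sample_dens_swap[OF assms n, of s]
    by eventually_elim (simp add: info_rate_eq mult.commute)
  show "inf_I P U V = inf_I P V U"
    unfolding inf_I_def by (rule compound_inf_cong[OF meas eq])
  show "sup_I P U V = sup_I P V U"
    unfolding sup_I_def compound_sup_eq_uminus_compound_inf
    by (intro arg_cong[where f = uminus] compound_inf_cong measurable_rate_uminus meas)
      (use eq in auto)
qed

end

subsection \<open>Discrete alphabets and chain rules\<close>

text \<open>Closed under \<open>joint\<close>, and so available for pairs of vectors, which are not
  themselves vectors over an alphabet.\<close>

definition discrete_ref :: "('w, 'v) rseq \<Rightarrow> bool" where
  "discrete_ref V \<longleftrightarrow> (\<forall>n\<ge>1. \<exists>A. countable A \<and> ref V n = count_space A)"

lemma ref_vector_discrete:
  assumes "discrete_alphabet M" "vector_rseq M V" "n \<ge> 1"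
  shows "ref V n = count_space ({..<n} \<rightarrow>\<^sub>E space M)"
proof -
  have "PiM {..<n} (\<lambda>_. count_space (space M)) = count_space ({..<n} \<rightarrow>\<^sub>E space M)"
    using assms(1) by (intro count_space_PiM_finite) (auto simp: discrete_alphabet_def)
  then show ?thesis
    using assms unfolding discrete_alphabet_def vector_rseq_def by metis
qed

lemma discrete_ref_vector:
  assumes "discrete_alphabet M" "vector_rseq M V"
  shows "discrete_ref V"
  using assms(1) unfolding discrete_ref_def
  by (auto simp: ref_vector_discrete[OF assms] discrete_alphabet_def
      intro!: exI[of _ "{..<_} \<rightarrow>\<^sub>E space M"] countable_PiE)

lemma discrete_ref_joint:
  assumes "discrete_ref U" "discrete_ref V"
  shows "discrete_ref (joint U V)"
  unfolding discrete_ref_def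
proof (intro allI impI)
  fix n :: nat assume "n \<ge> 1"
  then obtain A B where "countable A" "ref U n = count_space A" "countable B" "ref V n = count_space B"
    using assms unfolding discrete_ref_def by meson
  then show "\<exists>C. countable C \<and> ref (joint U V) n = count_space C"
    by (intro exI[of _ "A \<times> B"]) (simp add: ref_joint pair_measure_countable)
qed

text \<open>Every point has counting measure 1, so no null set blurs the density and the identity
  holds at each sample point, not merely almost surely.\<close>

lemma sample_dens_discrete:
  assumes "discrete_ref V" "has_dens P V" "n \<ge> 1" "\<omega> \<in> space (P s)"
  shows "sample_dens P V n s \<omega> = emeasure (P s) (rv V n -` {rv V n \<omega>} \<inter> space (P s))"
proof -
  obtain A where A: "ref V n = count_space A"
    using assms(1,3) unfolding discrete_ref_def by meson
  have "rv V n \<in> measurable (P s) (count_space A)"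
    using has_densD[OF assms(2,3), of s] A by (simp add: distributed_def)
  then have "rv V n \<omega> \<in> A"
    using assms(4) by (auto dest: measurable_space)
  then show ?thesis
    using has_densD[OF assms(2,3), of s] A by (intro distributed_count_space_countable) auto
qed

context compound_space
begin

section \<open>Chain rules as almost sure identities between reals\<close>

text \<open>All three densities are positive reals at the sample, so the logarithms separate. Having
  real \<open>i\<close> and \<open>c\<close> lets the identity be rearranged freely in
  \<open>ereal\<close>.\<close>

lemma ent_rate_decomposition:
  assumes "has_dens P (joint U V)" "has_dens P U" "has_dens P V" "n \<ge> 1"
  shows "AE \<omega> in P s. \<exists>i c. info_rate P U V n s \<omega> = ereal i \<and>
    cond_ent_rate P V U n s \<omega> = ereal c \<and> ent_rate P V n s \<omega> = ereal (i + c)"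
  using sample_dens_pos_finite[OF assms(1,4), of s] sample_dens_pos_finite[OF assms(2,4), of s]
    sample_dens_pos_finite[OF assms(3,4), of s]
proof eventually_elim
  case (elim \<omega>)
  then obtain a b c where "a > 0" "b > 0" "c > 0" "sample_dens P (joint U V) n s \<omega> = ennreal a"
    "sample_dens P U n s \<omega> = ennreal b" "sample_dens P V n s \<omega> = ennreal c"
    by auto
  \<comment> \<open>With a = p(x,y), b = p(x), c = p(y), the witnesses are the information density
    and -ln p(y|x), each divided by \<open>n\<close>.\<close>
  then show ?case
    using \<open>n \<ge> 1\<close>
    by (intro exI[of _ "(ln a - ln b - ln c) / n"] exI[of _ "(ln b - ln a) / n"])
      (simp add: info_rate_eq cond_ent_rate_eq ent_rate_def divide_ennreal ln_ext_ennreal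
        ennreal_mult[symmetric] ln_div ln_mult field_simps)
qed

lemma pair_info_rate_decomposition:
  assumes "has_dens P (joint (joint U V) W)" "has_dens P (joint U V)" "has_dens P (joint U W)"
    "has_dens P U" "has_dens P W" "n \<ge> 1"
  shows "AE \<omega> in P s. \<exists>i c. info_rate P U W n s \<omega> = ereal i \<and>
    cond_info_rate P V W U n s \<omega> = ereal c \<and> pair_info_rate P U V W n s \<omega> = ereal (i + c)"
  using sample_dens_pos_finite[OF assms(1,6), of s] sample_dens_pos_finite[OF assms(2,6), of s]
    sample_dens_pos_finite[OF assms(3,6), of s] sample_dens_pos_finite[OF assms(4,6), of s]
    sample_dens_pos_finite[OF assms(5,6), of s]
proof eventually_elim
  case (elim \<omega>)
  then obtain a b c d e where "a > 0" "b > 0" "c > 0" "d > 0" "e > 0"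
    "sample_dens P (joint (joint U V) W) n s \<omega> = ennreal a"
    "sample_dens P (joint U V) n s \<omega> = ennreal b"
    "sample_dens P (joint U W) n s \<omega> = ennreal c"
    "sample_dens P U n s \<omega> = ennreal d" "sample_dens P W n s \<omega> = ennreal e"
    by auto
  \<comment> \<open>Here a, b, c, d, e stand for p(x,y,z), p(x,y), p(x,z), p(x), p(z); in the sum of
    the witnesses ln c and ln d cancel.\<close>
  then show ?case
    using \<open>n \<ge> 1\<close>
    by (intro exI[of _ "(ln c - ln d - ln e) / n"] exI[of _ "(ln a + ln d - ln b - ln c) / n"])
      (simp add: info_rate_eq cond_info_rate_eq pair_info_rate_eq divide_ennreal ln_ext_ennreal
        ennreal_mult[symmetric] ln_div ln_mult field_simps)
qed

lemma inf_I_le_sup_I: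
  assumes "has_dens P (joint U V)" "has_dens P U" "has_dens P V"
  shows "inf_I P U V \<le> sup_I P U V"
  unfolding inf_I_def sup_I_def
  by (rule compound_inf_le_compound_sup[OF measurable_info_rate[OF assms]])

lemma inf_H_le_sup_H:
  assumes "has_dens P V"
  shows "inf_H P V \<le> sup_H P V"
  unfolding inf_H_def sup_H_def
  by (rule compound_inf_le_compound_sup[OF measurable_ent_rate[OF assms]])

section \<open>Information and entropy of a pair\<close>

context
  fixes U :: "('w, 'u) rseq" and V :: "('w, 'v) rseq"
  assumes UV: "has_dens P (joint U V)" and U: "has_dens P U" and V: "has_dens P V"
    and sf_V: "sigma_finite_ref V"
begin

text \<open>Superadditivity for h(y) = i(x;y) + h(y|x). The information term is nonnegative, so only
  the entropy term has to be kept away from \<open>-\<infinity>\<close>.\<close>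

lemma inf_I_add_inf_H_cond_le:
  assumes "inf_H_cond P V U \<noteq> -\<infinity>"
  shows "inf_I P U V + inf_H_cond P V U \<le> inf_H P V"
  unfolding inf_I_def inf_H_cond_def inf_H_def
proof (rule compound_inf_superadd)
  show "measurable_rate P (info_rate P U V)" "measurable_rate P (cond_ent_rate P V U)"
    by (rule measurable_info_rate[OF UV U V], rule measurable_cond_ent_rate[OF UV U])
  show "compound_inf P (info_rate P U V) \<noteq> -\<infinity>"
    using inf_I_nonneg[OF UV U V sf_V] by (auto simp: inf_I_def)
  show "compound_inf P (cond_ent_rate P V U) \<noteq> -\<infinity>"
    using assms by (simp add: inf_H_cond_def)
  fix n :: nat and s :: 's
  assume "n \<ge> 1"
  from ent_rate_decomposition[OF UV U V this, of s]
  show "AE \<omega> in P s. ent_rate P V n s \<omega> = info_rate P U V n s \<omega> + cond_ent_rate P V U n s \<omega>"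
    by eventually_elim auto
qed

text \<open>The chain rule read as -h(y|x) = i(x;y) + (-h(y)); negated upper rates are lower rates
  of the negated variables.\<close>

lemma inf_I_diff_sup_H_le:
  assumes "sup_H P V \<noteq> \<infinity>"
  shows "inf_I P U V + - sup_H P V \<le> - sup_H_cond P V U"
  unfolding inf_I_def sup_H_cond_def sup_H_def compound_sup_eq_uminus_compound_inf ereal_uminus_uminus
proof (rule compound_inf_superadd)
  show "measurable_rate P (info_rate P U V)" "measurable_rate P (\<lambda>n s \<omega>. - ent_rate P V n s \<omega>)"
    by (rule measurable_info_rate[OF UV U V], rule measurable_rate_uminus[OF measurable_ent_rate[OF V]])
  show "compound_inf P (info_rate P U V) \<noteq> -\<infinity>"
    using inf_I_nonneg[OF UV U V sf_V] by (auto simp: inf_I_def)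
  show "compound_inf P (\<lambda>n s \<omega>. - ent_rate P V n s \<omega>) \<noteq> -\<infinity>"
    using assms by (auto simp: sup_H_def compound_sup_eq_uminus_compound_inf)
  fix n :: nat and s :: 's
  assume "n \<ge> 1"
  from ent_rate_decomposition[OF UV U V this, of s]
  show "AE \<omega> in P s. - cond_ent_rate P V U n s \<omega> = info_rate P U V n s \<omega> + - ent_rate P V n s \<omega>"
    by eventually_elim auto
qed

text \<open>The chain rule solved for i(x;y) = h(y) + (-h(y|x)); both summands are entropies, so
  each needs its own condition at infinity.\<close>

lemma inf_H_diff_sup_H_cond_le:
  assumes "inf_H P V \<noteq> -\<infinity>" "sup_H_cond P V U \<noteq> \<infinity>"
  shows "inf_H P V + - sup_H_cond P V U \<le> inf_I P U V"
  unfolding inf_I_def sup_H_cond_def inf_H_def compound_sup_eq_uminus_compound_inf ereal_uminus_uminus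
proof (rule compound_inf_superadd)
  show "measurable_rate P (ent_rate P V)" "measurable_rate P (\<lambda>n s \<omega>. - cond_ent_rate P V U n s \<omega>)"
    by (rule measurable_ent_rate[OF V], rule measurable_rate_uminus[OF measurable_cond_ent_rate[OF UV U]])
  show "compound_inf P (ent_rate P V) \<noteq> -\<infinity>"
    using assms(1) by (simp add: inf_H_def)
  show "compound_inf P (\<lambda>n s \<omega>. - cond_ent_rate P V U n s \<omega>) \<noteq> -\<infinity>"
    using assms(2) by (auto simp: sup_H_cond_def compound_sup_eq_uminus_compound_inf)
  fix n :: nat and s :: 's
  assume "n \<ge> 1"
  from ent_rate_decomposition[OF UV U V this, of s]
  show "AE \<omega> in P s. info_rate P U V n s \<omega> = ent_rate P V n s \<omega> + - cond_ent_rate P V U n s \<omega>"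
    by eventually_elim auto
qed

text \<open>If \<open>sup_H\<close> is \<open>\<infinity>\<close>, then \<open>diff_defined\<close>
  rules out \<open>\<infinity> - \<infinity>\<close> and the right side is
  \<open>\<infinity>\<close>. The value \<open>-\<infinity>\<close> would force
  \<open>sup_H_cond\<close> to be \<open>-\<infinity>\<close> too, which \<open>diff_defined\<close>
  excludes.\<close>

lemma inf_I_le_sup_H_diff:
  assumes "diff_defined (sup_H P V) (sup_H_cond P V U)"
  shows "inf_I P U V \<le> sup_H P V - sup_H_cond P V U"
  using assms inf_I_diff_sup_H_le inf_I_nonneg[OF UV U V sf_V]
  by (cases "sup_H P V"; cases "sup_H_cond P V U"; cases "inf_I P U V") (auto simp: diff_defined_def)

lemma inf_I_le_inf_H_diff:
  assumes "diff_defined (inf_H P V) (inf_H_cond P V U)"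
  shows "inf_I P U V \<le> inf_H P V - inf_H_cond P V U"
  using assms inf_I_add_inf_H_cond_le inf_I_nonneg[OF UV U V sf_V]
  by (cases "inf_H P V"; cases "inf_H_cond P V U"; cases "inf_I P U V") (auto simp: diff_defined_def)

lemma inf_H_diff_le_inf_I:
  assumes "diff_defined (inf_H P V) (sup_H_cond P V U)"
  shows "inf_H P V - sup_H_cond P V U \<le> inf_I P U V"
  using assms inf_H_diff_sup_H_cond_le
  by (cases "inf_H P V"; cases "sup_H_cond P V U"; cases "inf_I P U V") (auto simp: diff_defined_def)

lemma sup_H_cond_le_sup_H: "sup_H_cond P V U \<le> sup_H P V"
  using inf_I_diff_sup_H_le inf_I_nonneg[OF UV U V sf_V]
  by (cases "sup_H P V"; cases "sup_H_cond P V U"; cases "inf_I P U V") auto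

lemma inf_H_cond_le_inf_H: "inf_H_cond P V U \<le> inf_H P V"
  using inf_I_add_inf_H_cond_le inf_I_nonneg[OF UV U V sf_V]
  by (cases "inf_H P V"; cases "inf_H_cond P V U"; cases "inf_I P U V") auto

text \<open>In the discrete case p(x,y) is the probability of a subevent of the one with probability
  p(x), so p(y|x) is at most 1 at the sample.\<close>

lemma cond_ent_rate_nonneg:
  assumes "discrete_ref U" "discrete_ref V" "n \<ge> 1"
  shows "AE \<omega> in P s. 0 \<le> cond_ent_rate P V U n s \<omega>"
  using sample_dens_pos_finite[OF UV assms(3), of s] sample_dens_pos_finite[OF U assms(3), of s] AE_space
proof eventually_elim
  case (elim \<omega>)
  then obtain a b where ab: "a > 0" "b > 0" "sample_dens P (joint U V) n s \<omega> = ennreal a"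
    "sample_dens P U n s \<omega> = ennreal b"
    by auto
  \<comment> \<open>Discreteness makes the singleton measurable, hence also the larger event, as
    monotonicity of \<open>emeasure\<close> requires.\<close>
  have "rv U n \<in> measurable (P s) (ref U n)"
    using has_densD[OF U assms(3), of s] by (simp add: distributed_def)
  moreover obtain A where "ref U n = count_space A"
    using assms(1,3) unfolding discrete_ref_def by meson
  moreover have "{rv U n \<omega>} \<in> sets (count_space A)" if "rv U n \<in> measurable (P s) (count_space A)"
    using measurable_space[OF that, of \<omega>] elim by simp
  ultimately have "rv U n -` {rv U n \<omega>} \<inter> space (P s) \<in> sets (P s)"
    by (metis measurable_sets)
  then have "sample_dens P (joint U V) n s \<omega> \<le> sample_dens P U n s \<omega>"
    using elim
    unfolding sample_dens_discrete[OF discrete_ref_joint[OF assms(1,2)] UV assms(3) elim(3)]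
      sample_dens_discrete[OF assms(1) U assms(3) elim(3)]
    by (intro emeasure_mono) (auto simp: rv_joint)
  with ab have "a / b \<le> 1" by (simp add: ennreal_le_iff)
  with ab have "ln (a / b) \<le> 0" by simp
  with ab show ?case
    by (simp add: cond_ent_rate_eq divide_ennreal ln_ext_ennreal divide_nonpos_nonneg)
qed

lemma inf_H_cond_nonneg:
  assumes "discrete_ref U" "discrete_ref V"
  shows "0 \<le> inf_H_cond P V U"
  unfolding inf_H_cond_def by (rule compound_inf_nonneg[OF cond_ent_rate_nonneg[OF assms]])

text \<open>Compared sample by sample rather than through differences of rates, which could be
  \<open>\<infinity> - \<infinity>\<close> on infinite alphabets.\<close>

lemma info_rate_le_ent_rate:
  assumes "discrete_ref U" "discrete_ref V" "n \<ge> 1"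
  shows "AE \<omega> in P s. info_rate P U V n s \<omega> \<le> ent_rate P V n s \<omega>"
  using ent_rate_decomposition[OF UV U V assms(3), of s] cond_ent_rate_nonneg[OF assms, of s]
  by eventually_elim auto

lemma inf_I_le_inf_H:
  assumes "discrete_ref U" "discrete_ref V"
  shows "inf_I P U V \<le> inf_H P V"
  unfolding inf_I_def inf_H_def
  by (rule compound_inf_mono[OF measurable_info_rate[OF UV U V] info_rate_le_ent_rate[OF assms]])

lemma sup_I_le_sup_H:
  assumes "discrete_ref U" "discrete_ref V"
  shows "sup_I P U V \<le> sup_H P V"
  unfolding sup_I_def sup_H_def
  by (rule compound_sup_mono[OF measurable_ent_rate[OF V] info_rate_le_ent_rate[OF assms]])

lemma inf_H_le_inf_I:
  assumes "sup_H_cond P V U = 0"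
  shows "inf_H P V \<le> inf_I P U V"
  using inf_H_diff_le_inf_I by (simp add: assms diff_defined_def)

end

section \<open>Information of a pair about a third sequence\<close>

context
  fixes U :: "('w, 'u) rseq" and V :: "('w, 'v) rseq" and W :: "('w, 'z) rseq"
  assumes UVW: "has_dens P (joint (joint U V) W)" and UV: "has_dens P (joint U V)"
    and UW: "has_dens P (joint U W)" and U: "has_dens P U" and W: "has_dens P W"
    and sf: "sigma_finite_ref U" "sigma_finite_ref V" "sigma_finite_ref W"
begin

text \<open>Both summands are nonnegative, so superadditivity applies to the chain rule with no
  condition at infinity.\<close>

lemma inf_I_pair_ge: "inf_I P U W + inf_I_cond P V W U \<le> inf_I_pair P U V W"
  unfolding inf_I_def inf_I_cond_def inf_I_pair_def
proof (rule compound_inf_superadd)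
  show "measurable_rate P (info_rate P U W)" "measurable_rate P (cond_info_rate P V W U)"
    by (rule measurable_info_rate[OF UW U W], rule measurable_cond_info_rate[OF UVW UV UW U])
  show "compound_inf P (info_rate P U W) \<noteq> -\<infinity>"
    using inf_I_nonneg[OF UW U W sf(3)] by (auto simp: inf_I_def)
  show "compound_inf P (cond_info_rate P V W U) \<noteq> -\<infinity>"
    using inf_I_cond_nonneg[OF UVW UV UW U sf] by (auto simp: inf_I_cond_def)
  fix n :: nat and s :: 's
  assume "n \<ge> 1"
  from pair_info_rate_decomposition[OF UVW UV UW U W this, of s]
  show "AE \<omega> in P s. pair_info_rate P U V W n s \<omega> =
      info_rate P U W n s \<omega> + cond_info_rate P V W U n s \<omega>"
    by eventually_elim auto
qed

text \<open>The chain rule solved for i(x;z); this is the reverse bound behind the equality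
  case.\<close>

lemma inf_I_pair_diff_sup_I_cond_le:
  assumes "sup_I_cond P V W U \<noteq> \<infinity>"
  shows "inf_I_pair P U V W + - sup_I_cond P V W U \<le> inf_I P U W"
  unfolding inf_I_def sup_I_cond_def inf_I_pair_def compound_sup_eq_uminus_compound_inf ereal_uminus_uminus
proof (rule compound_inf_superadd)
  show "measurable_rate P (pair_info_rate P U V W)"
    "measurable_rate P (\<lambda>n s \<omega>. - cond_info_rate P V W U n s \<omega>)"
    by (rule measurable_pair_info_rate[OF UVW UV W],
        rule measurable_rate_uminus[OF measurable_cond_info_rate[OF UVW UV UW U]])
  have "0 \<le> inf_I_pair P U V W"
    using inf_I_pair_ge inf_I_nonneg[OF UW U W sf(3)] inf_I_cond_nonneg[OF UVW UV UW U sf]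
    by (meson add_nonneg_nonneg order_trans)
  then show "compound_inf P (pair_info_rate P U V W) \<noteq> -\<infinity>"
    by (auto simp: inf_I_pair_def)
  show "compound_inf P (\<lambda>n s \<omega>. - cond_info_rate P V W U n s \<omega>) \<noteq> -\<infinity>"
    using assms by (auto simp: sup_I_cond_def compound_sup_eq_uminus_compound_inf)
  fix n :: nat and s :: 's
  assume "n \<ge> 1"
  from pair_info_rate_decomposition[OF UVW UV UW U W this, of s]
  show "AE \<omega> in P s. info_rate P U W n s \<omega> =
      pair_info_rate P U V W n s \<omega> + - cond_info_rate P V W U n s \<omega>"
    by eventually_elim auto
qed

text \<open>A vanishing upper conditional rate squeezes the nonnegative lower one to 0, so both
  bounds on \<open>inf_I_pair\<close> collapse to \<open>inf_I\<close>.\<close>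

lemma inf_I_pair_eq:
  assumes "sup_I_cond P V W U = 0"
  shows "inf_I_pair P U V W = inf_I P U W" "inf_I_cond P V W U = 0"
proof -
  have "inf_I_cond P V W U \<le> sup_I_cond P V W U"
    unfolding inf_I_cond_def sup_I_cond_def
    by (rule compound_inf_le_compound_sup[OF measurable_cond_info_rate[OF UVW UV UW U]])
  with assms inf_I_cond_nonneg[OF UVW UV UW U sf] show "inf_I_cond P V W U = 0"
    by simp
  then show "inf_I_pair P U V W = inf_I P U W"
    using inf_I_pair_ge inf_I_pair_diff_sup_I_cond_le assms by (simp add: antisym)
qed

end

section \<open>Entropy of a finite alphabet\<close>

text \<open>With N letters there are N^n vectors, so \<open>G = 1\<close> has integral N^n. The
  ratio to \<open>G\<close> is the density itself, whose log-rate is minus the entropy rate.\<close>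

lemma sup_H_le_ln_card:
  assumes V: "has_dens P V" and M: "discrete_alphabet M" "vector_rseq M V" "finite (space M)"
  shows "sup_H P V \<le> ln_card M"
proof -
  let ?K = "real (card (space M))"
  note ref = ref_vector_discrete[OF M(1,2)]
  \<comment> \<open>Secures \<open>0 < K\<close>: a probability space is nonempty and maps into the
    vectors of length 1. Length 0 would not do, a product over no coordinates being a single
    point.\<close>
  have "space M \<noteq> {}"
  proof
    assume "space M = {}"
    then have "space (ref V 1) = {}"
      by (simp add: ref PiE_eq_empty_iff)
    then have "space (P s) = {}" for s
      using has_densD[OF V, of 1 s] by (auto simp: distributed_def dest: measurable_space)
    then show False
      using prob_space.not_empty[OF prob_space_P] by auto
  qed
  then have "0 < ?K"
    using M(3) by (simp add: card_gt_0_iff)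
  have "ereal (- ln ?K) \<le> compound_inf P (\<lambda>n s \<omega>. ereal (1 / real n) *
      ln_ext (sample_dens P V n s \<omega> / (\<lambda>_ _ _. 1) n s (rv V n \<omega>)))"
  proof (rule compound_inf_ln_ratio_ge[OF V \<open>0 < ?K\<close>])
    fix n :: nat and s :: 's
    assume n: "n \<ge> 1"
    have "(\<integral>\<^sup>+v. 1 \<partial>ref V n) = ennreal (card ({..<n} \<rightarrow>\<^sub>E space M))"
      using M(3) by (simp add: ref[OF n] finite_PiE ennreal_of_nat_eq_real_of_nat)
    then show "(\<integral>\<^sup>+v. 1 \<partial>ref V n) \<le> ennreal (?K ^ n)"
      by (simp add: card_PiE)
  qed simp
  also have "\<dots> = - sup_H P V"
    by (simp add: sup_H_def compound_sup_eq_uminus_compound_inf ent_rate_def divide_ennreal_def)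
  finally show ?thesis
    by (metis ereal_minus_le_minus uminus_ereal.simps(1))
qed

end

section \<open>Assembly for three sequences with a joint density\<close>

text \<open>The divergence claim ranges over \<open>X'\<close> on the alphabet of \<open>X\<close>,
  because the second density is evaluated at samples of \<open>X\<close>. Differences of entropy
  rates are guarded by \<open>diff_defined\<close>, as rates may be infinite.\<close>

theorem proposition8:
  fixes P :: "'s \<Rightarrow> 'w measure"
    and Mx :: "'a measure" and My :: "'b measure" and Mz :: "'c measure"
    and X :: "('w, nat \<Rightarrow> 'a) rseq"
    and Y :: "('w, nat \<Rightarrow> 'b) rseq"
    and Z :: "('w, nat \<Rightarrow> 'c) rseq"
  assumes "\<And>s. prob_space (P s)"
    and "sigma_finite_measure Mx" and "sigma_finite_measure My" and "sigma_finite_measure Mz"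
    and "vector_rseq Mx X" and "vector_rseq My Y" and "vector_rseq Mz Z"
    and "has_density P (joint (joint X Y) Z)"
  shows
    "(\<forall>X'. vector_rseq Mx X' \<and> has_density P X' \<longrightarrow> inf_D P X X' \<ge> 0)
   \<and> sup_I P X Y \<ge> inf_I P X Y \<and> inf_I P X Y \<ge> 0
   \<and> inf_I P X Y = inf_I P Y X
   \<and> (diff_defined (sup_H P Y) (sup_H_cond P Y X) \<longrightarrow>
        inf_I P X Y \<le> sup_H P Y - sup_H_cond P Y X)
   \<and> (diff_defined (inf_H P Y) (inf_H_cond P Y X) \<longrightarrow>
        inf_I P X Y \<le> inf_H P Y - inf_H_cond P Y X)
   \<and> (diff_defined (inf_H P Y) (sup_H_cond P Y X) \<longrightarrow>
        inf_I P X Y \<ge> inf_H P Y - sup_H_cond P Y X)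
   \<and> sup_H P Y \<ge> sup_H_cond P Y X
   \<and> sup_H P Y \<ge> inf_H P Y \<and> inf_H P Y \<ge> inf_H_cond P Y X
   \<and> inf_I_pair P X Y Z \<ge> inf_I P X Z + inf_I_cond P Y Z X
   \<and> inf_I P X Z + inf_I_cond P Y Z X \<ge> inf_I P X Z
   \<and> (sup_I_cond P Y Z X = 0 \<longrightarrow>
        inf_I_pair P X Y Z = inf_I P X Z + inf_I_cond P Y Z X
      \<and> inf_I P X Z + inf_I_cond P Y Z X = inf_I P X Z)
   \<and> (discrete_alphabet Mx \<and> discrete_alphabet My \<longrightarrow>
        0 \<le> inf_H_cond P X Y \<and> inf_H_cond P X Y \<le> inf_H P X \<and> inf_H P X \<le> sup_H P X
      \<and> (finite (space Mx) \<longrightarrow> sup_H P X \<le> ln_card Mx)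
      \<and> 0 \<le> inf_I P X Y \<and> inf_I P X Y \<le> min (inf_H P X) (inf_H P Y)
      \<and> (finite (space Mx) \<and> finite (space My) \<longrightarrow>
           min (inf_H P X) (inf_H P Y) \<le> min (ln_card Mx) (ln_card My))
      \<and> (min (sup_H_cond P Y X) (sup_H_cond P X Y) = 0 \<longrightarrow>
           inf_I P X Y = min (inf_H P X) (inf_H P Y))
      \<and> 0 \<le> sup_I P X Y \<and> sup_I P X Y \<le> min (sup_H P X) (sup_H P Y)
      \<and> (finite (space Mx) \<and> finite (space My) \<longrightarrow>
           min (sup_H P X) (sup_H P Y) \<le> min (ln_card Mx) (ln_card My)))"
proof -
  interpret compound_space P
    using assms(1) by (rule compound_space.intro)
  have sfX: "sigma_finite_ref X" and sfY: "sigma_finite_ref Y" and sfZ: "sigma_finite_ref Z"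
    using assms(2-7) by (auto intro: sigma_finite_ref_vector)
  have XYZ: "has_dens P (joint (joint X Y) Z)"
    using assms(8) by (simp add: has_dens_iff_has_density)
  \<comment> \<open>The densities of all marginals of the triple are obtained from its joint density
    by integrating out.\<close>
  have XY: "has_dens P (joint X Y)"
    by (rule has_dens_fst[OF XYZ sigma_finite_ref_joint[OF sfX sfY] sfZ])
  have Z: "has_dens P Z"
    by (rule has_dens_snd[OF XYZ sigma_finite_ref_joint[OF sfX sfY] sfZ])
  note XZ = has_dens_drop_middle[OF XYZ sfX sfY sfZ]
  note YX = has_dens_swap[OF XY sfX sfY]
  note X = has_dens_fst[OF XY sfX sfY] and Y = has_dens_snd[OF XY sfX sfY]
  note I_sym = inf_I_sym[OF XY sfX sfY]
  note I_nonneg = inf_I_nonneg[OF XY X Y sfY] inf_I_nonneg[OF XZ X Z sfZ]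
  note triple = XYZ XY XZ X Z sfX sfY sfZ
  have D: "inf_D P X X' \<ge> 0" if "vector_rseq Mx X'" "has_density P X'" for X'
    using that assms(5) by (intro inf_D_nonneg X) (auto simp: has_dens_iff_has_density vector_rseq_def)
  have discrete: "0 \<le> inf_H_cond P X Y \<and> inf_H_cond P X Y \<le> inf_H P X \<and> inf_H P X \<le> sup_H P X
      \<and> (finite (space Mx) \<longrightarrow> sup_H P X \<le> ln_card Mx)
      \<and> 0 \<le> inf_I P X Y \<and> inf_I P X Y \<le> min (inf_H P X) (inf_H P Y)
      \<and> (finite (space Mx) \<and> finite (space My) \<longrightarrow>
           min (inf_H P X) (inf_H P Y) \<le> min (ln_card Mx) (ln_card My))
      \<and> (min (sup_H_cond P Y X) (sup_H_cond P X Y) = 0 \<longrightarrow>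
           inf_I P X Y = min (inf_H P X) (inf_H P Y))
      \<and> 0 \<le> sup_I P X Y \<and> sup_I P X Y \<le> min (sup_H P X) (sup_H P Y)
      \<and> (finite (space Mx) \<and> finite (space My) \<longrightarrow>
           min (sup_H P X) (sup_H P Y) \<le> min (ln_card Mx) (ln_card My))"
    if "discrete_alphabet Mx \<and> discrete_alphabet My"
  proof -
    have dX: "discrete_ref X" and dY: "discrete_ref Y"
      using that assms(5,6) by (auto intro: discrete_ref_vector)
    have "inf_I P X Y \<le> min (inf_H P X) (inf_H P Y)"
      using inf_I_le_inf_H[OF XY X Y sfY dX dY] inf_I_le_inf_H[OF YX Y X sfX dY dX]
      by (simp add: I_sym)
    moreover have "sup_I P X Y \<le> min (sup_H P X) (sup_H P Y)"
      using sup_I_le_sup_H[OF XY X Y sfY dX dY] sup_I_le_sup_H[OF YX Y X sfX dY dX]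
      by (simp add: I_sym)
    \<comment> \<open>A vanishing upper entropy of Y given X bounds the lower entropy of Y by the
      information; the other case is the same for X, by symmetry of information.\<close>
    moreover have "min (inf_H P X) (inf_H P Y) \<le> inf_I P X Y"
      if "min (sup_H_cond P Y X) (sup_H_cond P X Y) = 0"
    proof -
      from that consider "sup_H_cond P Y X = 0" | "sup_H_cond P X Y = 0"
        by (auto simp: min_def split: if_splits)
      then show ?thesis
      proof cases
        case 1
        from inf_H_le_inf_I[OF XY X Y sfY this] show ?thesis
          by (rule min.coboundedI2)
      next
        case 2
        from inf_H_le_inf_I[OF YX Y X sfX this] show ?thesis
          unfolding I_sym by (rule min.coboundedI1)
      qed
    qed
    moreover have lnX: "sup_H P X \<le> ln_card Mx" if "finite (space Mx)"
      using sup_H_le_ln_card[OF X _ assms(5) that] \<open>discrete_alphabet Mx \<and> discrete_alphabet My\<close>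
      by simp
    moreover have lnY: "sup_H P Y \<le> ln_card My" if "finite (space My)"
      using sup_H_le_ln_card[OF Y _ assms(6) that] \<open>discrete_alphabet Mx \<and> discrete_alphabet My\<close>
      by simp
    moreover have "min (sup_H P X) (sup_H P Y) \<le> min (ln_card Mx) (ln_card My)"
      if "finite (space Mx) \<and> finite (space My)"
      using that lnX lnY by (intro min.mono) auto
    \<comment> \<open>The bound by \<open>ln_card\<close> is proved for upper entropies and reaches
      the lower ones through this.\<close>
    moreover have "min (inf_H P X) (inf_H P Y) \<le> min (sup_H P X) (sup_H P Y)"
      by (intro min.mono inf_H_le_sup_H X Y)
    ultimately show ?thesis
      using inf_H_cond_nonneg[OF YX Y X sfX dY dX] inf_H_cond_le_inf_H[OF YX Y X sfX]
        inf_H_le_sup_H[OF X] I_nonneg inf_I_le_sup_I[OF XY X Y]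
      by (auto simp del: min_le_iff_disj min.bounded_iff intro: order_trans antisym)
  qed
  have pair: "inf_I_pair P X Y Z \<ge> inf_I P X Z + inf_I_cond P Y Z X"
    "inf_I P X Z + inf_I_cond P Y Z X \<ge> inf_I P X Z"
    using inf_I_pair_ge[OF triple] add_left_mono[OF inf_I_cond_nonneg[OF XYZ XY XZ X sfX sfY sfZ]]
    by auto
  have pair_eq: "inf_I_pair P X Y Z = inf_I P X Z + inf_I_cond P Y Z X \<and>
      inf_I P X Z + inf_I_cond P Y Z X = inf_I P X Z" if "sup_I_cond P Y Z X = 0"
    using inf_I_pair_eq[OF triple that] by simp
  show ?thesis
    by (intro conjI impI allI discrete D pair pair_eq[THEN conjunct1] pair_eq[THEN conjunct2]
        inf_I_le_sup_I[OF XY X Y] I_nonneg(1) I_sym(1) inf_I_le_sup_H_diff[OF XY X Y sfY]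
        inf_I_le_inf_H_diff[OF XY X Y sfY] inf_H_diff_le_inf_I[OF XY X Y sfY]
        sup_H_cond_le_sup_H[OF XY X Y sfY] inf_H_le_sup_H[OF Y] inf_H_cond_le_inf_H[OF XY X Y sfY]) auto
qed

end
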